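(* Let $T>0$ and the spatial mesh size $h>0$ be fixed. Let $f:\mathbb{R}\to\mathbb{R}$ and $\beta>0$ be such that $f(\beta)\le0\le f(-\beta)$ and $f$ is continuously differentiable and nonconstant on $[-\beta,\beta]$, and let $\|u_0\|_{L^\infty}\le\beta$. Assume that $\boldsymbol u\in\mathcal C([0,T];\mathbb{R}^N)$, with $\|\boldsymbol u(t)\|_\infty\le\beta$ for all $t\in[0,T]$, is the exact solution of $$\frac{d\boldsymbol u}{dt}=\boldsymbol A\boldsymbol u+\boldsymbol f(\boldsymbol u),\qquad \boldsymbol u(0)=(u_0(x_1),\dots,u_0(x_N))^T,$$ and that $\{\boldsymbol U_m\}_{m=0}^M$ is the numerical solution generated by the LRI1a scheme $$\boldsymbol U_0=\boldsymbol u(0),\qquad \boldsymbol U_{m+1}=e^{\Delta t\boldsymbol A}\bigl(\boldsymbol U_m+\Delta t\,\boldsymbol f(\boldsymbol U_m)\bigr),\quad m=0,\dots,M-1.$$ Then there exists a constant $C=C(\beta,F_0,F_1,\|\boldsymbol A\|_\infty)>0$, independent of $\Delta t$, such that for all $0<\Delta t\le\omega_0$, $$\|\boldsymbol U_m-\boldsymbol u(t_m)\|_\infty\le C\,(e^{F_1t_m}-1)\,\Delta t,\qquad m=0,1,\dots,M.$$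
   Context: Setting (space discretization by central finite differences, homogeneous Neumann boundary conditions, of $\partial_t u=\varepsilon^2\Delta u+f(u)$ on $\Omega$ with initial datum $u_0:\overline\Omega\to\mathbb{R}$): $d\in\{1,2,3\}$, $\Omega\subset\mathbb{R}^d$ is an open bounded interval ($d=1$), rectangle ($d=2$) or rectangular parallelepiped ($d=3$), $\varepsilon>0$. A uniform grid with mesh size $h>0$ in every direction is used, with $n_k\ge2$ grid points (boundary points included) in direction $k$, $N=n_1\cdots n_d$, and grid points $x_1,\dots,x_N\in\overline\Omega$ (first coordinate varying fastest). For $n\ge 2$ let $\boldsymbol\lambda_h^{(n)}$ be $\frac1{h^2}$ times the $n\times n$ tridiagonal matrix with all diagonal entries $-2$, first row $(-2,2,0,\dots,0)$, last row $(0,\dots,0,2,-2)$, and every interior row having entries $1,-2,1$ in the sub-, main and superdiagonal positions. Set $\boldsymbol D_h=\boldsymbol\lambda_h^{(n_1)}$ if $d=1$; $\boldsymbol D_h=\boldsymbol I\otimes\boldsymbol\lambda_h^{(n_1)}+\boldsymbol\lambda_h^{(n_2)}\otimes\boldsymbol I$ if $d=2$; $\boldsymbol D_h=\boldsymbol I\otimes\boldsymbol I\otimes\boldsymbol\lambda_h^{(n_1)}+\boldsymbol I\otimes\boldsymbol\lambda_h^{(n_2)}\otimes\boldsymbol I+\boldsymbol\lambda_h^{(n_3)}\otimes\boldsymbol I\otimes\boldsymbol I$ if $d=3$ ($\otimes$ is the Kronecker product, $\boldsymbol I$ identity matrices of the appropriate sizes), and $\boldsymbol A=\varepsilon^2\boldsymbol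 D_h\in\mathbb{R}^{N\times N}$. Time grid: $M$ is a positive integer, $\Delta t=T/M$, $t_m=m\Delta t$. Constants: $\omega_0=-1/\min_{|x|\le\beta}f'(x)>0$ (the minimum is negative), $F_0=\max_{|x|\le\beta}|f(x)|$, $F_1=\max_{|x|\le\beta}|f'(x)|$. Notation: $\boldsymbol f(\boldsymbol v)=(f(v_1),\dots,f(v_N))^T$ for $\boldsymbol v\in\mathbb{R}^N$; $\|\cdot\|_\infty$ is the maximum norm on $\mathbb{R}^N$ and the induced matrix norm; $\|u_0\|_{L^\infty}=\max_{x\in\overline\Omega}|u_0(x)|$. *)

theory Defs
  imports "HOL-Analysis.Analysis" "Jordan_Normal_Form.Matrix"
begin

text \<open>The dimension \<open>N\<close> of the semidiscrete system is a value and not a type, so vectors and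
  matrices are those of \<open>Jordan_Normal_Form\<close>.  The names it shares with \<open>HOL-Analysis\<close> are
  resolved in its favour.\<close>

hide_type (open) Finite_Cartesian_Product.vec
hide_const (open) Finite_Cartesian_Product.vec Finite_Cartesian_Product.mat
no_notation Finite_Cartesian_Product.vec_nth (infixl \<open>$\<close> 90)

subsection \<open>Norms\<close>

definition max_norm :: "real vec \<Rightarrow> real" where
  "max_norm v = Max ((\<lambda>i. \<bar>v $ i\<bar>) ` {..<dim_vec v})"

definition mat_max_norm :: "real mat \<Rightarrow> real" where
  "mat_max_norm A =
     (SUP v \<in> {v \<in> carrier_vec (dim_col A). max_norm v \<le> 1}. max_norm (A *\<^sub>v v))"

text \<open>The supremum is taken in \<^typ>\<open>ereal\<close>, so the value is \<open>\<infinity>\<close> for an unbounded function.\<close>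

definition sup_norm_on :: "'a set \<Rightarrow> ('a \<Rightarrow> real) \<Rightarrow> ereal" where
  "sup_norm_on S g = (SUP x\<in>S. ereal \<bar>g x\<bar>)"

subsection \<open>Matrix exponential and Kronecker product\<close>

definition mat_exp :: "real mat \<Rightarrow> real mat" where
  "mat_exp A = mat (dim_row A) (dim_row A) (\<lambda>(i, j). \<Sum>k. (A ^\<^sub>m k) $$ (i, j) / fact k)"

definition kronecker :: "real mat \<Rightarrow> real mat \<Rightarrow> real mat" (infixl \<open>\<otimes>\<^sub>K\<close> 70) where
  "A \<otimes>\<^sub>K B = mat (dim_row A * dim_row B) (dim_col A * dim_col B)
     (\<lambda>(i, j). A $$ (i div dim_row B, j div dim_col B) * B $$ (i mod dim_row B, j mod dim_col B))"

subsection \<open>Grid\<close>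

text \<open>A point of \<open>\<real>\<^sup>d\<close> is a vector of dimension \<open>d\<close>; the list \<open>ns = [n\<^sub>1, \<dots>, n\<^sub>d]\<close> gives the numbers
  of grid points per direction.  The closure of the open box with lower corner \<open>a\<close> and
  upper corner \<open>b\<close> is \<open>closed_box a b\<close>.\<close>

definition closed_box :: "real vec \<Rightarrow> real vec \<Rightarrow> real vec set" where
  "closed_box a b = {x \<in> carrier_vec (dim_vec a). \<forall>k<dim_vec a. a $ k \<le> x $ k \<and> x $ k \<le> b $ k}"

definition uniform_grid :: "real \<Rightarrow> nat list \<Rightarrow> real vec \<Rightarrow> real vec \<Rightarrow> bool" where
  "uniform_grid h ns a b \<longleftrightarrow>
     h > 0 \<and> length ns \<in> {1, 2, 3} \<and> (\<forall>n\<in>set ns. n \<ge> 2) \<and>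
     a \<in> carrier_vec (length ns) \<and> b \<in> carrier_vec (length ns) \<and>
     (\<forall>k<length ns. b $ k = a $ k + real (ns ! k - 1) * h)"

text \<open>Mixed-radix digits of \<open>i\<close>: the first coordinate varies fastest.\<close>

definition grid_point :: "real \<Rightarrow> nat list \<Rightarrow> real vec \<Rightarrow> nat \<Rightarrow> real vec" where
  "grid_point h ns a i =
     vec (length ns) (\<lambda>k. a $ k + real (i div prod_list (take k ns) mod ns ! k) * h)"

definition grid_restriction ::
    "real \<Rightarrow> nat list \<Rightarrow> real vec \<Rightarrow> (real vec \<Rightarrow> real) \<Rightarrow> real vec" where
  "grid_restriction h ns a g = vec (prod_list ns) (\<lambda>i. g (grid_point h ns a i))"

subsection \<open>Discrete Neumann Laplacian\<close>

definition neumann_matrix :: "real \<Rightarrow> nat \<Rightarrow> real mat" where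
  "neumann_matrix h n = (1 / h\<^sup>2) \<cdot>\<^sub>m mat n n (\<lambda>(i, j).
     if i = j then - 2
     else if (i = 0 \<and> j = 1) \<or> (i + 1 = n \<and> j + 2 = n) then 2
     else if j = i + 1 \<or> i = j + 1 then 1
     else 0)"

fun discrete_laplacian :: "real \<Rightarrow> nat list \<Rightarrow> real mat" where
  "discrete_laplacian h [n1] = neumann_matrix h n1"
| "discrete_laplacian h [n1, n2] =
     1\<^sub>m n2 \<otimes>\<^sub>K neumann_matrix h n1 + neumann_matrix h n2 \<otimes>\<^sub>K 1\<^sub>m n1"
| "discrete_laplacian h [n1, n2, n3] =
     1\<^sub>m n3 \<otimes>\<^sub>K 1\<^sub>m n2 \<otimes>\<^sub>K neumann_matrix h n1 +
     1\<^sub>m n3 \<otimes>\<^sub>K neumann_matrix h n2 \<otimes>\<^sub>K 1\<^sub>m n1 +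
     neumann_matrix h n3 \<otimes>\<^sub>K 1\<^sub>m n2 \<otimes>\<^sub>K 1\<^sub>m n1"
| "discrete_laplacian h ns = undefined"

definition system_matrix :: "real \<Rightarrow> real \<Rightarrow> nat list \<Rightarrow> real mat" where
  "system_matrix \<epsilon> h ns = \<epsilon>\<^sup>2 \<cdot>\<^sub>m discrete_laplacian h ns"

subsection \<open>Nonlinearity\<close>

text \<open>On a nondegenerate interval the derivative \<open>f'\<close> (one-sided at the end points) is uniquely
  determined by \<open>f\<close>.  As \<open>f\<close> and \<open>f'\<close> are continuous on \<open>[-\<beta>, \<beta>]\<close>, the infimum and the suprema
  below are attained.\<close>

definition C1_on_with_deriv :: "real set \<Rightarrow> (real \<Rightarrow> real) \<Rightarrow> (real \<Rightarrow> real) \<Rightarrow> bool" where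
  "C1_on_with_deriv S f f' \<longleftrightarrow>
     (\<forall>x\<in>S. (f has_real_derivative f' x) (at x within S)) \<and> continuous_on S f'"

definition omega0 :: "(real \<Rightarrow> real) \<Rightarrow> real \<Rightarrow> real" where
  "omega0 f' \<beta> = - 1 / (INF x\<in>{-\<beta>..\<beta>}. f' x)"

definition max_abs :: "(real \<Rightarrow> real) \<Rightarrow> real \<Rightarrow> real" where
  "max_abs g \<beta> = (SUP x\<in>{-\<beta>..\<beta>}. \<bar>g x\<bar>)"

subsection \<open>Semidiscrete solution and time stepping\<close>

definition exact_solution ::
    "real mat \<Rightarrow> (real \<Rightarrow> real) \<Rightarrow> real \<Rightarrow> real vec \<Rightarrow> (real \<Rightarrow> real vec) \<Rightarrow> bool" where
  "exact_solution A f T v u \<longleftrightarrow>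
     (\<forall>t\<in>{0..T}. u t \<in> carrier_vec (dim_row A)) \<and>
     (\<forall>i<dim_row A. continuous_on {0..T} (\<lambda>t. u t $ i)) \<and>
     (\<forall>t\<in>{0..T}. \<forall>i<dim_row A.
        ((\<lambda>s. u s $ i) has_real_derivative (A *\<^sub>v u t + map_vec f (u t)) $ i)
          (at t within {0..T})) \<and>
     u 0 = v"

definition LRI1a ::
    "real mat \<Rightarrow> (real \<Rightarrow> real) \<Rightarrow> real \<Rightarrow> nat \<Rightarrow> real vec \<Rightarrow> (nat \<Rightarrow> real vec) \<Rightarrow> bool" where
  "LRI1a A f dt M v U \<longleftrightarrow>
     U 0 = v \<and>
     (\<forall>m<M. U (Suc m) = mat_exp (dt \<cdot>\<^sub>m A) *\<^sub>v (U m + dt \<cdot>\<^sub>v map_vec f (U m)))"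

end

theory Submission
  imports Defs
begin

text \<open>The system matrix is a rate matrix: its off-diagonal entries are nonnegative and its rows sum to
  zero.  Hence \<open>exp (t A)\<close> is a contraction in the maximum norm for \<open>t \<ge> 0\<close>.  As \<open>\<tau> \<le> \<omega>\<^sub>0\<close> makes
  \<open>x + \<tau> f x\<close> nondecreasing on \<open>[-\<beta>, \<beta>]\<close>, the numerical solution stays in \<open>[-\<beta>, \<beta>]\<close>, and one step
  is Lipschitz with constant \<open>1 + \<tau> F\<^sub>1\<close>.  Differentiating \<open>exp ((\<tau> - r) A) u(t + r)\<close> in \<open>r\<close> and
  comparing with the slope \<open>exp (\<tau> A) f(u(t))\<close> bounds the local error by \<open>L \<tau>\<^sup>2\<close>, where
  \<open>L = F\<^sub>1 (\<parallel>A\<parallel> \<beta> + F\<^sub>0) + \<parallel>A\<parallel> F\<^sub>0\<close>.  Summing up gives the error bound with constant \<open>L / F\<^sub>1\<close>.\<close>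

subsection \<open>Maximum norms\<close>

lemma abs_vec_index_le_max_norm:
  assumes "i < dim_vec v"
  shows "\<bar>v $ i\<bar> \<le> max_norm v"
  unfolding max_norm_def using assms by (intro Max_ge) auto

lemma max_norm_le_iff:
  assumes "0 < dim_vec v"
  shows "max_norm v \<le> c \<longleftrightarrow> (\<forall>i<dim_vec v. \<bar>v $ i\<bar> \<le> c)"
  unfolding max_norm_def using assms by (subst Max_le_iff) auto

lemma max_norm_nonneg:
  assumes "0 < dim_vec v"
  shows "0 \<le> max_norm v"
  using abs_vec_index_le_max_norm[OF assms] abs_ge_zero order_trans by blast

lemma mult_mat_vec_index_sum:
  assumes "A \<in> carrier_mat m n" "v \<in> carrier_vec n" "i < m"
  shows "(A *\<^sub>v v) $ i = (\<Sum>j<n. A $$ (i, j) * v $ j)"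
  using assms by (auto simp: scalar_prod_def lessThan_atLeast0 intro!: sum.cong)

lemma mult_mat_index_sum:
  assumes "A \<in> carrier_mat m n" "B \<in> carrier_mat n p" "i < m" "j < p"
  shows "(A * B) $$ (i, j) = (\<Sum>l<n. A $$ (i, l) * B $$ (l, j))"
  using assms by (auto simp: scalar_prod_def lessThan_atLeast0 intro!: sum.cong)

text \<open>\<open>mat_max_norm\<close> is a supremum of reals, which bounds its members only if the
  family is bounded above. The sum of all absolute entries is a crude but sufficient bound.\<close>

lemma mat_max_norm_bdd:
  fixes A :: "real mat"
  assumes A: "A \<in> carrier_mat m n" and "0 < m"
  shows "bdd_above ((\<lambda>v. max_norm (A *\<^sub>v v)) ` {v \<in> carrier_vec (dim_col A). max_norm v \<le> 1})"
proof (rule bdd_aboveI2)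
  fix v assume v: "v \<in> {v \<in> carrier_vec (dim_col A). max_norm v \<le> 1}"
  have "\<bar>(A *\<^sub>v v) $ i\<bar> \<le> (\<Sum>i<m. \<Sum>j<n. \<bar>A $$ (i, j)\<bar>)" if i: "i < m" for i
  proof -
    have "\<bar>v $ j\<bar> \<le> 1" if "j < n" for j
      using abs_vec_index_le_max_norm[of j v] that v A by auto
    then have "\<bar>(A *\<^sub>v v) $ i\<bar> \<le> (\<Sum>j<n. \<bar>A $$ (i, j)\<bar> * 1)"
      using v A i by (subst mult_mat_vec_index_sum[of A m n])
        (auto intro!: order_trans[OF sum_abs] sum_mono mult_left_le simp: abs_mult)
    also have "\<dots> \<le> (\<Sum>i<m. \<Sum>j<n. \<bar>A $$ (i, j)\<bar>)"
      using i by (simp, intro member_le_sum[of i _ "\<lambda>i. \<Sum>j<n. \<bar>A $$ (i, j)\<bar>"]) (auto intro: sum_nonneg)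
    finally show ?thesis .
  qed
  then show "max_norm (A *\<^sub>v v) \<le> (\<Sum>i<m. \<Sum>j<n. \<bar>A $$ (i, j)\<bar>)"
    using assms by (subst max_norm_le_iff) auto
qed

text \<open>Scaling moves a vector of positive norm into the unit ball, where the supremum applies.
  A vector of norm zero cannot be scaled and is treated separately.\<close>

lemma max_norm_mult_mat_vec_le:
  assumes A: "A \<in> carrier_mat m n" and pos: "0 < m" "0 < n" and v: "v \<in> carrier_vec n"
  shows "max_norm (A *\<^sub>v v) \<le> mat_max_norm A * max_norm v"
proof (cases "max_norm v = 0")
  case True
  then have "v $ j = 0" if "j < n" for j
    using abs_vec_index_le_max_norm[of j v] that v by auto
  then have "(A *\<^sub>v v) $ i = 0" if "i < m" for i
    using that A v by (simp add: mult_mat_vec_index_sum[of A m n] del: index_mult_mat_vec)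
  then show ?thesis
    using True A pos by (subst max_norm_le_iff) auto
next
  case False
  then have c: "max_norm v > 0"
    using max_norm_nonneg[of v] v pos by auto
  define w where "w = (1 / max_norm v) \<cdot>\<^sub>v v"
  have w: "w \<in> carrier_vec n" using v by (simp add: w_def)
  have "max_norm w \<le> 1"
    using v c pos abs_vec_index_le_max_norm[of _ v] by (subst max_norm_le_iff) (auto simp: w_def abs_mult)
  then have le: "max_norm (A *\<^sub>v w) \<le> mat_max_norm A"
    unfolding mat_max_norm_def using w A pos
    by (intro cSUP_upper mat_max_norm_bdd) auto
  have "\<bar>(A *\<^sub>v v) $ i\<bar> \<le> mat_max_norm A * max_norm v" if i: "i < m" for i
  proof -
    have "(A *\<^sub>v w) $ i = (A *\<^sub>v v) $ i / max_norm v"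
      using A v by (simp add: w_def mult_mat_vec[OF A v] i del: index_mult_mat_vec)
    moreover have "\<bar>(A *\<^sub>v w) $ i\<bar> \<le> mat_max_norm A"
      using abs_vec_index_le_max_norm[of i "A *\<^sub>v w"] le A i by auto
    ultimately show ?thesis
      using c by (simp add: pos_divide_le_eq)
  qed
  then show ?thesis
    using A pos by (subst max_norm_le_iff) auto
qed

lemma mat_max_norm_nonneg:
  fixes A :: "real mat"
  assumes A: "A \<in> carrier_mat m n" and pos: "0 < m" "0 < n"
  shows "0 \<le> mat_max_norm A"
proof -
  \<comment> \<open>The all-ones vector has norm one, so the induced norm dominates the nonnegative
    norm of its image.\<close>
  have "max_norm (vec n (\<lambda>_. 1::real)) = 1"
    unfolding max_norm_def using pos by (auto simp: image_constant_conv)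
  moreover have "0 \<le> max_norm (A *\<^sub>v vec n (\<lambda>_. 1))"
    using A pos by (intro max_norm_nonneg) auto
  ultimately show ?thesis
    using max_norm_mult_mat_vec_le[OF A pos, of "vec n (\<lambda>_. 1)"] by simp
qed

subsection \<open>The matrix exponential\<close>

text \<open>\<open>pow_mat\<close> unfolds with the new factor on the right; estimating powers
  applied to a vector needs it on the left.\<close>

lemma pow_mat_Suc_left:
  assumes "A \<in> carrier_mat n n"
  shows "A ^\<^sub>m Suc k = A * A ^\<^sub>m k"
proof (induction k)
  case (Suc k)
  have "A ^\<^sub>m Suc (Suc k) = A * A ^\<^sub>m k * A"
    using Suc by simp
  then show ?case
    using assms by (simp add: assoc_mult_mat[of _ n n _ n _ n])
qed (use assms in simp)

lemma pow_mat_smult: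
  fixes A :: "real mat"
  assumes "A \<in> carrier_mat n n"
  shows "(t \<cdot>\<^sub>m A) ^\<^sub>m k = t ^ k \<cdot>\<^sub>m A ^\<^sub>m k"
  by (induction k) (use assms in \<open>auto simp: mult_smult_distrib[of _ n n _ n] mult_smult_assoc_mat[of _ n n _ n]
    intro!: eq_matI\<close>)

text \<open>A product entry is a sum of \<open>n\<close> terms, so each further factor
  \<open>A\<close> costs at most \<open>real n * b\<close>. Such geometric growth is dominated by
  the factorials of the exponential series.\<close>

lemma pow_mat_entry_le:
  fixes A :: "real mat"
  assumes A: "A \<in> carrier_mat n n" and b: "\<And>i j. i < n \<Longrightarrow> j < n \<Longrightarrow> \<bar>A $$ (i, j)\<bar> \<le> b"
    and ij: "i < n" "j < n"
  shows "\<bar>(A ^\<^sub>m k) $$ (i, j)\<bar> \<le> (real n * b) ^ k"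
  using ij
proof (induction k arbitrary: j)
  case (Suc k)
  have b0: "0 \<le> b" using b[OF Suc.prems] by simp
  have "\<bar>(A ^\<^sub>m Suc k) $$ (i, j)\<bar> = \<bar>\<Sum>l<n. (A ^\<^sub>m k) $$ (i, l) * A $$ (l, j)\<bar>"
    using A Suc.prems by (simp add: mult_mat_index_sum[of _ n n _ n] del: index_mult_mat)
  also have "\<dots> \<le> (\<Sum>l<n. (real n * b) ^ k * b)"
    using Suc b b0 by (intro order_trans[OF sum_abs] sum_mono) (auto simp: abs_mult intro!: mult_mono)
  finally show ?case by (simp add: ac_simps)
qed (use A in auto)

text \<open>Fixed coefficients times powers of \<open>t\<close> make termwise differentiation
  available later. The majorant is the scalar exponential series at
  \<open>real n * b * \<bar>t\<bar>\<close>.\<close>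

lemma summable_mat_exp_entry:
  fixes A :: "real mat"
  assumes A: "A \<in> carrier_mat n n" and "i < n" "j < n"
  shows "summable (\<lambda>k. (A ^\<^sub>m k) $$ (i, j) / fact k * t ^ k)"
proof (rule summable_comparison_test)
  define b where "b = (\<Sum>i<n. \<Sum>j<n. \<bar>A $$ (i, j)\<bar>)"
  have b: "\<bar>A $$ (i, j)\<bar> \<le> b" if "i < n" "j < n" for i j
  proof -
    have "\<bar>A $$ (i, j)\<bar> \<le> (\<Sum>j<n. \<bar>A $$ (i, j)\<bar>)"
      using that by (intro member_le_sum[of j _ "\<lambda>j. \<bar>A $$ (i, j)\<bar>"]) auto
    also have "\<dots> \<le> b"
      unfolding b_def using that
      by (intro member_le_sum[of i _ "\<lambda>i. \<Sum>j<n. \<bar>A $$ (i, j)\<bar>"]) (auto intro: sum_nonneg)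
    finally show ?thesis .
  qed
  show "\<exists>N. \<forall>k\<ge>N. norm ((A ^\<^sub>m k) $$ (i, j) / fact k * t ^ k) \<le> inverse (fact k) * (real n * b * \<bar>t\<bar>) ^ k"
  proof (intro exI allI impI)
    fix k
    have "\<bar>(A ^\<^sub>m k) $$ (i, j)\<bar> / fact k * \<bar>t\<bar> ^ k \<le> (real n * b) ^ k / fact k * \<bar>t\<bar> ^ k"
      using pow_mat_entry_le[OF A b assms(2,3)] by (intro mult_right_mono divide_right_mono) auto
    then show "norm ((A ^\<^sub>m k) $$ (i, j) / fact k * t ^ k) \<le> inverse (fact k) * (real n * b * \<bar>t\<bar>) ^ k"
      by (simp add: abs_mult power_abs power_mult_distrib divide_inverse mult_ac)
  qed
  show "summable (\<lambda>k. inverse (fact k) * (real n * b * \<bar>t\<bar>) ^ k)"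
    by (rule summable_exp)
qed

lemma mat_exp_carrier: "A \<in> carrier_mat n n \<Longrightarrow> mat_exp A \<in> carrier_mat n n"
  by (auto simp: mat_exp_def)

lemma mat_exp_entry:
  fixes A :: "real mat"
  assumes A: "A \<in> carrier_mat n n" and "i < n" "j < n"
  shows "mat_exp (t \<cdot>\<^sub>m A) $$ (i, j) = (\<Sum>k. (A ^\<^sub>m k) $$ (i, j) / fact k * t ^ k)"
  using assms by (simp add: mat_exp_def pow_mat_smult[OF A] mult_ac)

lemma mat_exp_entry_sums:
  fixes A :: "real mat"
  assumes A: "A \<in> carrier_mat n n" and ij: "i < n" "j < n"
  shows "(\<lambda>k. (A ^\<^sub>m k) $$ (i, j) / fact k * t ^ k) sums mat_exp (t \<cdot>\<^sub>m A) $$ (i, j)"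
  unfolding mat_exp_entry[OF assms] by (rule summable_sums[OF summable_mat_exp_entry[OF assms]])

lemma mat_exp_mult_vec_sums:
  fixes A :: "real mat"
  assumes A: "A \<in> carrier_mat n n" and v: "v \<in> carrier_vec n" and i: "i < n"
  shows "(\<lambda>k. (A ^\<^sub>m k *\<^sub>v v) $ i * (t ^ k / fact k)) sums (mat_exp (t \<cdot>\<^sub>m A) *\<^sub>v v) $ i"
proof -
  have "(\<lambda>k. \<Sum>j<n. (A ^\<^sub>m k) $$ (i, j) / fact k * t ^ k * v $ j) sums
      (\<Sum>j<n. mat_exp (t \<cdot>\<^sub>m A) $$ (i, j) * v $ j)"
    using A i by (intro sums_sum sums_mult2 mat_exp_entry_sums) auto
  then show ?thesis
    using A v i mat_exp_carrier[of "t \<cdot>\<^sub>m A" n]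
    by (simp add: mult_mat_vec_index_sum[of _ n n] sum_distrib_left mult_ac
        sum_divide_distrib del: index_mult_mat_vec)
qed

section \<open>Value at zero and derivatives of the matrix exponential\<close>

lemma mat_exp_zero_smult:
  fixes A :: "real mat"
  assumes A: "A \<in> carrier_mat n n"
  shows "mat_exp (0 \<cdot>\<^sub>m A) = 1\<^sub>m n"
proof (rule eq_matI)
  fix i j assume "i < dim_row (1\<^sub>m n :: real mat)" "j < dim_col (1\<^sub>m n :: real mat)"
  then show "mat_exp (0 \<cdot>\<^sub>m A) $$ (i, j) = 1\<^sub>m n $$ (i, j)"
    using A mat_exp_entry[OF A, of i j 0] powser_zero[of "\<lambda>k. (A ^\<^sub>m k) $$ (i, j) / fact k"] by simp
qed (use A in \<open>auto simp: mat_exp_def\<close>)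

text \<open>The series is differentiated termwise; the last factor \<open>A\<close> of each power
  does not depend on \<open>k\<close> and leaves the series on the right.\<close>

lemma mat_exp_entry_has_derivative:
  fixes A :: "real mat"
  assumes A: "A \<in> carrier_mat n n" and ij: "i < n" "j < n"
  shows "((\<lambda>t. mat_exp (t \<cdot>\<^sub>m A) $$ (i, j)) has_real_derivative (mat_exp (t \<cdot>\<^sub>m A) * A) $$ (i, j)) (at t)"
proof -
  have "((\<lambda>t. \<Sum>k. (A ^\<^sub>m k) $$ (i, j) / fact k * t ^ k) has_real_derivative
      (\<Sum>k. diffs (\<lambda>k. (A ^\<^sub>m k) $$ (i, j) / fact k) k * t ^ k)) (at t)"
    by (intro termdiffs_strong_converges_everywhere summable_mat_exp_entry[OF A ij])
  moreover have "(\<Sum>k. diffs (\<lambda>k. (A ^\<^sub>m k) $$ (i, j) / fact k) k * t ^ k) = (mat_exp (t \<cdot>\<^sub>m A) * A) $$ (i, j)"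
  proof -
    have "diffs (\<lambda>k. (A ^\<^sub>m k) $$ (i, j) / fact k) k * t ^ k =
        (\<Sum>l<n. (A ^\<^sub>m k) $$ (i, l) / fact k * t ^ k * A $$ (l, j))" for k
    proof -
      have "(A ^\<^sub>m Suc k) $$ (i, j) = (\<Sum>l<n. (A ^\<^sub>m k) $$ (i, l) * A $$ (l, j))"
        using A ij by (simp add: mult_mat_index_sum[of _ n n _ n] del: index_mult_mat)
      \<comment> \<open>The factor \<open>k + 1\<close> from the differentiation cancels against
        \<open>fact (k + 1)\<close>.\<close>
      moreover have "diffs (\<lambda>k. (A ^\<^sub>m k) $$ (i, j) / fact k) k = (A ^\<^sub>m Suc k) $$ (i, j) / fact k"
        by (simp add: diffs_def del: pow_mat.simps of_nat_Suc)
      ultimately show ?thesis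
        by (simp add: sum_distrib_right sum_distrib_left sum_divide_distrib mult_ac)
    qed
    moreover have "(\<Sum>k. \<Sum>l<n. (A ^\<^sub>m k) $$ (i, l) / fact k * t ^ k * A $$ (l, j)) =
       (\<Sum>l<n. \<Sum>k. (A ^\<^sub>m k) $$ (i, l) / fact k * t ^ k * A $$ (l, j))"
      using A ij by (intro suminf_sum summable_mult2 summable_mat_exp_entry) auto
    moreover have "\<dots> = (\<Sum>l<n. mat_exp (t \<cdot>\<^sub>m A) $$ (i, l) * A $$ (l, j))"
      using A ij by (intro sum.cong refl sums_unique[symmetric] sums_mult2 mat_exp_entry_sums) auto
    ultimately show ?thesis
      using A ij mat_exp_carrier[of "t \<cdot>\<^sub>m A" n] by (simp add: mult_mat_index_sum[of _ n n _ n] del: index_mult_mat)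
  qed
  ultimately show ?thesis
    using A ij by (simp add: mat_exp_entry)
qed

text \<open>This replaces the integral in the variation-of-constants formula.\<close>

lemma mat_exp_diff_mult_has_derivative:
  fixes A :: "real mat" and y :: "real \<Rightarrow> real vec"
  assumes A: "A \<in> carrier_mat n n" and i: "i < n" and s: "s \<in> S"
    and y: "\<And>r. r \<in> S \<Longrightarrow> y r \<in> carrier_vec n" and y': "y' \<in> carrier_vec n"
    and der: "\<And>j. j < n \<Longrightarrow> ((\<lambda>r. y r $ j) has_real_derivative y' $ j) (at s within S)"
  shows "((\<lambda>r. (mat_exp ((\<tau> - r) \<cdot>\<^sub>m A) *\<^sub>v y r) $ i) has_real_derivative
     (mat_exp ((\<tau> - s) \<cdot>\<^sub>m A) *\<^sub>v (y' - A *\<^sub>v y s)) $ i) (at s within S)"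
proof -
  let ?E = "\<lambda>r. mat_exp ((\<tau> - r) \<cdot>\<^sub>m A)"
  have E: "?E r \<in> carrier_mat n n" for r
    using A by (intro mat_exp_carrier) auto
  have EA: "?E r * A \<in> carrier_mat n n" for r
    using A E[of r] by (intro mult_carrier_mat)
  have d: "((\<lambda>r. ?E r $$ (i, j)) has_real_derivative - (?E s * A) $$ (i, j)) (at s within S)" if "j < n" for j
  proof -
    have "((\<lambda>r. \<tau> - r) has_real_derivative - 1) (at s within S)"
      by (auto intro!: derivative_eq_intros)
    from DERIV_chain2[where f = "\<lambda>t. mat_exp (t \<cdot>\<^sub>m A) $$ (i, j)",
        OF mat_exp_entry_has_derivative[OF A i that] this]
    show ?thesis by simp
  qed
  have "((\<lambda>r. \<Sum>j<n. ?E r $$ (i, j) * y r $ j) has_real_derivative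
    (\<Sum>j<n. ?E s $$ (i, j) * y' $ j - (?E s * A) $$ (i, j) * y s $ j)) (at s within S)"
    by (intro DERIV_sum) (auto intro!: derivative_eq_intros d der simp del: index_mult_mat)
  moreover have "(\<Sum>j<n. ?E s $$ (i, j) * y' $ j - (?E s * A) $$ (i, j) * y s $ j) =
      (?E s *\<^sub>v (y' - A *\<^sub>v y s)) $ i"
  proof -
    \<comment> \<open>By the product rule the exponential contributes the factor
      \<open>- (?E s * A)\<close>; associativity merges this with
      \<open>?E s *\<^sub>v y'\<close>.\<close>
    have "?E s *\<^sub>v (y' - A *\<^sub>v y s) = ?E s *\<^sub>v y' - (?E s * A) *\<^sub>v y s"
      using mult_minus_distrib_mat_vec[OF E y' mult_mat_vec_carrier[OF A y[OF s]]]
        assoc_mult_mat_vec[OF E A y[OF s]] by simp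
    then show ?thesis
      using E[of s] EA[of s] i y[OF s] y'
      by (simp add: mult_mat_vec_index_sum[of _ n n] sum_subtractf del: index_mult_mat_vec index_mult_mat assoc_mult_mat_vec)
  qed
  ultimately have "((\<lambda>r. \<Sum>j<n. ?E r $$ (i, j) * y r $ j) has_real_derivative
      (?E s *\<^sub>v (y' - A *\<^sub>v y s)) $ i) (at s within S)"
    by simp
  \<comment> \<open>The vectors \<open>y r\<close> are known to have dimension \<open>n\<close> only
    on \<open>S\<close>, so the two functions are identified only there; any positive radius
    serves.\<close>
  then show ?thesis
  proof (rule has_field_derivative_transform_within[where d = 1, OF _ _ s])
    show "(0 :: real) < 1" by simp
    show "(\<Sum>j<n. ?E r $$ (i, j) * y r $ j) = (?E r *\<^sub>v y r) $ i" if "r \<in> S" for r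
      by (rule mult_mat_vec_index_sum[OF E y[OF that] i, symmetric])
  qed
qed

text \<open>Every power of \<open>A\<close> commutes with \<open>A\<close>, and a finite sum passes
  through the series; uniqueness of the limit does the rest.\<close>

lemma mat_exp_commute_mult_vec:
  fixes A :: "real mat"
  assumes A: "A \<in> carrier_mat n n" and v: "v \<in> carrier_vec n"
  shows "mat_exp (t \<cdot>\<^sub>m A) *\<^sub>v (A *\<^sub>v v) = A *\<^sub>v (mat_exp (t \<cdot>\<^sub>m A) *\<^sub>v v)"
proof (rule eq_vecI)
  fix i assume "i < dim_vec (A *\<^sub>v (mat_exp (t \<cdot>\<^sub>m A) *\<^sub>v v))"
  then have i: "i < n" using A by simp
  have P: "A ^\<^sub>m k \<in> carrier_mat n n" for k using A by simp
  have E: "mat_exp (t \<cdot>\<^sub>m A) \<in> carrier_mat n n"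
    using A by (intro mat_exp_carrier) auto
  have "(\<lambda>k. \<Sum>j<n. A $$ (i, j) * ((A ^\<^sub>m k *\<^sub>v v) $ j * (t ^ k / fact k))) sums
     (\<Sum>j<n. A $$ (i, j) * (mat_exp (t \<cdot>\<^sub>m A) *\<^sub>v v) $ j)"
    using A v by (intro sums_sum sums_mult mat_exp_mult_vec_sums) auto
  moreover have "(\<Sum>j<n. A $$ (i, j) * ((A ^\<^sub>m k *\<^sub>v v) $ j * (t ^ k / fact k))) =
      (A ^\<^sub>m k *\<^sub>v (A *\<^sub>v v)) $ i * (t ^ k / fact k)" for k
  proof -
    have "A ^\<^sub>m k *\<^sub>v (A *\<^sub>v v) = A *\<^sub>v (A ^\<^sub>m k *\<^sub>v v)"
      using A v P[of k] pow_mat_Suc_left[OF A, of k]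
      by (metis assoc_mult_mat_vec pow_mat.simps(2))
    then show ?thesis
      using A v i P[of k] mult_mat_vec_index_sum[OF A, of "A ^\<^sub>m k *\<^sub>v v" i]
      by (simp add: sum_distrib_left mult_ac sum_divide_distrib mult_mat_vec_carrier[OF P v] del: index_mult_mat_vec)
  qed
  ultimately have "(\<lambda>k. (A ^\<^sub>m k *\<^sub>v (A *\<^sub>v v)) $ i * (t ^ k / fact k)) sums (A *\<^sub>v (mat_exp (t \<cdot>\<^sub>m A) *\<^sub>v v)) $ i"
    using A v i E by (simp add: mult_mat_vec_index_sum[of A n n] del: index_mult_mat_vec)
  then show "(mat_exp (t \<cdot>\<^sub>m A) *\<^sub>v (A *\<^sub>v v)) $ i = (A *\<^sub>v (mat_exp (t \<cdot>\<^sub>m A) *\<^sub>v v)) $ i"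
    using sums_unique2[OF mat_exp_mult_vec_sums[OF A _ i]] A v by (metis mult_mat_vec_carrier)
qed (use A in \<open>auto simp: mat_exp_def\<close>)

text \<open>The exponential series is dominated by the scalar one for \<open>c * t\<close>. The
  growth constant is left as a parameter so that the shift of a rate matrix can be inserted
  exactly.\<close>

lemma mat_exp_norm_le:
  fixes A :: "real mat"
  assumes A: "A \<in> carrier_mat n n" and n: "0 < n" and c: "0 \<le> c" and t: "0 \<le> t"
    and le: "\<And>w. w \<in> carrier_vec n \<Longrightarrow> max_norm (A *\<^sub>v w) \<le> c * max_norm w"
    and v: "v \<in> carrier_vec n"
  shows "max_norm (mat_exp (t \<cdot>\<^sub>m A) *\<^sub>v v) \<le> exp (c * t) * max_norm v"
proof -
  have P: "A ^\<^sub>m k \<in> carrier_mat n n" for k using A by simp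
  have pow: "max_norm (A ^\<^sub>m k *\<^sub>v v) \<le> c ^ k * max_norm v" for k
  proof (induction k)
    case (Suc k)
    have "A ^\<^sub>m Suc k *\<^sub>v v = A *\<^sub>v (A ^\<^sub>m k *\<^sub>v v)"
      using A v P[of k] pow_mat_Suc_left[OF A, of k] by (metis assoc_mult_mat_vec)
    then have "max_norm (A ^\<^sub>m Suc k *\<^sub>v v) \<le> c * max_norm (A ^\<^sub>m k *\<^sub>v v)"
      using le P v by (simp add: mult_mat_vec_carrier[OF P v])
    also have "\<dots> \<le> c * (c ^ k * max_norm v)"
      using c Suc by (rule mult_left_mono[rotated])
    finally show ?case by simp
  qed (use A v in simp)
  have "\<bar>(mat_exp (t \<cdot>\<^sub>m A) *\<^sub>v v) $ i\<bar> \<le> exp (c * t) * max_norm v" if i: "i < n" for i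
  proof -
    have g: "(\<lambda>k. (c * t) ^ k /\<^sub>R fact k * max_norm v) sums (exp (c * t) * max_norm v)"
      by (intro sums_mult2 exp_converges)
    have "\<bar>(A ^\<^sub>m k *\<^sub>v v) $ i * (t ^ k / fact k)\<bar> \<le> (c * t) ^ k /\<^sub>R fact k * max_norm v" for k
    proof -
      have "\<bar>(A ^\<^sub>m k *\<^sub>v v) $ i\<bar> \<le> c ^ k * max_norm v"
        using abs_vec_index_le_max_norm[of i "A ^\<^sub>m k *\<^sub>v v"] pow[of k] P[of k] i by auto
      then have "\<bar>(A ^\<^sub>m k *\<^sub>v v) $ i\<bar> * (t ^ k / fact k) \<le> c ^ k * max_norm v * (t ^ k / fact k)"
        using t by (intro mult_right_mono) auto
      then show ?thesis
        using t by (simp add: abs_mult power_mult_distrib divide_inverse mult_ac)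
    qed
    then have "norm (\<Sum>k. (A ^\<^sub>m k *\<^sub>v v) $ i * (t ^ k / fact k)) \<le> (\<Sum>k. (c * t) ^ k /\<^sub>R fact k * max_norm v)"
      using g by (intro norm_suminf_le) (auto simp: sums_iff)
    then show ?thesis
      using g mat_exp_mult_vec_sums[OF A v i, of t] by (simp add: sums_iff)
  qed
  moreover have "mat_exp (t \<cdot>\<^sub>m A) \<in> carrier_mat n n"
    using A by (intro mat_exp_carrier) auto
  ultimately show ?thesis
    using n by (subst max_norm_le_iff) auto
qed

lemma mat_exp_mult_vec_has_derivative:
  fixes A :: "real mat"
  assumes A: "A \<in> carrier_mat n n" and v: "v \<in> carrier_vec n" and i: "i < n"
  shows "((\<lambda>t. (mat_exp (t \<cdot>\<^sub>m A) *\<^sub>v v) $ i) has_real_derivative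
    (mat_exp (t \<cdot>\<^sub>m A) *\<^sub>v (A *\<^sub>v v)) $ i) (at t within S)"
proof -
  \<comment> \<open>With the matrix \<open>- A\<close>, \<open>\<tau> = 0\<close> and a constant
    curve, the product rule reduces to the derivative of the exponential, with \<open>A\<close>
    already acting on \<open>v\<close>.\<close>
  have "((\<lambda>r. (mat_exp ((0 - r) \<cdot>\<^sub>m (- A)) *\<^sub>v v) $ i) has_real_derivative
     (mat_exp ((0 - t) \<cdot>\<^sub>m (- A)) *\<^sub>v (0\<^sub>v n - (- A) *\<^sub>v v)) $ i) (at t within UNIV)"
    using A v i by (intro mat_exp_diff_mult_has_derivative) auto
  moreover have "(0 - r) \<cdot>\<^sub>m (- A) = r \<cdot>\<^sub>m A" for r
    using A by (intro eq_matI) auto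
  moreover have "0\<^sub>v n - (- A) *\<^sub>v v = A *\<^sub>v v"
    using A v by (intro eq_vecI) auto
  ultimately show ?thesis
    using has_field_derivative_at_within by simp
qed

subsection \<open>Rate matrices\<close>

text \<open>These are the generators of continuous-time Markov chains on \<open>n\<close> states;
  their exponentials for nonnegative times have nonnegative entries and unit row sums.\<close>

definition rate_matrix :: "nat \<Rightarrow> real mat \<Rightarrow> bool" where
  "rate_matrix n A \<longleftrightarrow> A \<in> carrier_mat n n \<and>
     (\<forall>i<n. \<forall>j<n. i \<noteq> j \<longrightarrow> 0 \<le> A $$ (i, j)) \<and> (\<forall>i<n. (\<Sum>j<n. A $$ (i, j)) = 0)"

text \<open>A large enough shift makes all entries nonnegative, and each row then sums to exactly
  \<open>c\<close>. The growth constant therefore equals the shift itself.\<close>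

lemma rate_matrix_shift_norm_le:
  assumes A: "rate_matrix n A" and n: "0 < n"
  obtains c where "0 \<le> c"
    "\<And>v. v \<in> carrier_vec n \<Longrightarrow> max_norm ((A + c \<cdot>\<^sub>m 1\<^sub>m n) *\<^sub>v v) \<le> c * max_norm v"
proof
  \<comment> \<open>Any bound for the absolute diagonal entries would do; their sum avoids taking a
    maximum.\<close>
  define c where "c = (\<Sum>i<n. \<bar>A $$ (i, i)\<bar>)"
  show c0: "0 \<le> c" by (simp add: c_def sum_nonneg)
  fix v :: "real vec" assume v: "v \<in> carrier_vec n"
  have cA: "A \<in> carrier_mat n n" using A by (simp add: rate_matrix_def)
  have "\<bar>((A + c \<cdot>\<^sub>m 1\<^sub>m n) *\<^sub>v v) $ i\<bar> \<le> c * max_norm v" if i: "i < n" for i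
  proof -
    have "\<bar>A $$ (i, i)\<bar> \<le> c"
      unfolding c_def using i by (intro member_le_sum[of i _ "\<lambda>i. \<bar>A $$ (i, i)\<bar>"]) auto
    then have pos: "0 \<le> (A + c \<cdot>\<^sub>m 1\<^sub>m n) $$ (i, j)" if "j < n" for j
      using that i A by (cases "i = j") (auto simp: rate_matrix_def)
    have "\<bar>((A + c \<cdot>\<^sub>m 1\<^sub>m n) *\<^sub>v v) $ i\<bar> \<le> (\<Sum>j<n. (A + c \<cdot>\<^sub>m 1\<^sub>m n) $$ (i, j) * max_norm v)"
      using v i cA pos abs_vec_index_le_max_norm[of _ v]
      by (subst mult_mat_vec_index_sum[of _ n n])
        (auto intro!: order_trans[OF sum_abs] sum_mono mult_left_mono simp: abs_mult
          simp del: index_add_mat(1))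
    also have "\<dots> = c * max_norm v"
      using i cA A
      by (simp add: sum_distrib_right[symmetric] sum.distrib rate_matrix_def flip: sum_distrib_left)
    finally show ?thesis .
  qed
  then show "max_norm ((A + c \<cdot>\<^sub>m 1\<^sub>m n) *\<^sub>v v) \<le> c * max_norm v"
    using n cA by (subst max_norm_le_iff) auto
qed

text \<open>Shifting by \<open>c I\<close> makes the growth bound \<^term>\<open>exp (c * t)\<close> of the exponential exactly
  cancel the factor \<^term>\<open>exp (- (c * t))\<close>.\<close>

lemma rate_matrix_mat_exp_contraction:
  assumes A: "rate_matrix n A" and n: "0 < n" and t: "0 \<le> t" and v: "v \<in> carrier_vec n"
  shows "max_norm (mat_exp (t \<cdot>\<^sub>m A) *\<^sub>v v) \<le> max_norm v"
proof -
  obtain c where c: "0 \<le> c"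
    and le: "\<And>v. v \<in> carrier_vec n \<Longrightarrow> max_norm ((A + c \<cdot>\<^sub>m 1\<^sub>m n) *\<^sub>v v) \<le> c * max_norm v"
    using rate_matrix_shift_norm_le[OF A n] by blast
  define B where "B = A + c \<cdot>\<^sub>m 1\<^sub>m n"
  have cA: "A \<in> carrier_mat n n" using A by (simp add: rate_matrix_def)
  have cB: "B \<in> carrier_mat n n" using cA by (simp add: B_def)
  have E: "mat_exp (s \<cdot>\<^sub>m A) \<in> carrier_mat n n" for s
    using cA by (intro mat_exp_carrier) auto
  have EB: "mat_exp (s \<cdot>\<^sub>m B) \<in> carrier_mat n n" for s
    using cB by (intro mat_exp_carrier) auto
  \<comment> \<open>\<open>y\<close> solves \<open>y' = B y\<close> with \<open>y 0 = v\<close>: the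
    scalar factor supplies the part \<open>c I\<close> of \<open>B\<close>.\<close>
  define y where "y = (\<lambda>s. exp (c * s) \<cdot>\<^sub>v (mat_exp (s \<cdot>\<^sub>m A) *\<^sub>v v))"
  have y: "y s \<in> carrier_vec n" for s
    using E v by (simp add: y_def mult_mat_vec_carrier[OF E v])
  have By: "(B *\<^sub>v y s) $ j = exp (c * s) * ((mat_exp (s \<cdot>\<^sub>m A) *\<^sub>v (A *\<^sub>v v)) $ j + c * (mat_exp (s \<cdot>\<^sub>m A) *\<^sub>v v) $ j)"
    if j: "j < n" for s j
  proof -
    have "B *\<^sub>v y s = exp (c * s) \<cdot>\<^sub>v (B *\<^sub>v (mat_exp (s \<cdot>\<^sub>m A) *\<^sub>v v))"
      unfolding y_def using cB mult_mat_vec_carrier[OF E v] by (intro mult_mat_vec)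
    moreover have "(B *\<^sub>v w) $ j = (A *\<^sub>v w) $ j + c * w $ j" if w: "w \<in> carrier_vec n" for w
    proof -
      have "(B *\<^sub>v w) $ j = (\<Sum>k<n. A $$ (j, k) * w $ k + (if k = j then c * w $ k else 0))"
        using cA cB w j by (subst mult_mat_vec_index_sum[of _ n n])
          (auto simp: B_def algebra_simps intro!: sum.cong)
      then show ?thesis
        using cA w j by (simp add: sum.distrib mult_mat_vec_index_sum[of A n n] del: index_mult_mat_vec)
    qed
    ultimately show ?thesis
      using cB j mult_mat_vec_carrier[OF E v]
      by (simp add: mat_exp_commute_mult_vec[OF cA v] del: index_mult_mat_vec)
  qed
  have dy: "((\<lambda>s. y s $ j) has_real_derivative (B *\<^sub>v y s) $ j) (at s within {0..t})" if j: "j < n" for s j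
  proof -
    have "((\<lambda>s. exp (c * s) * (mat_exp (s \<cdot>\<^sub>m A) *\<^sub>v v) $ j) has_real_derivative (B *\<^sub>v y s) $ j) (at s within {0..t})"
      unfolding By[OF j]
      by (rule derivative_eq_intros mat_exp_mult_vec_has_derivative[OF cA v j] refl
          | simp add: algebra_simps del: index_mult_mat_vec)+
    moreover have "y s $ j = exp (c * s) * (mat_exp (s \<cdot>\<^sub>m A) *\<^sub>v v) $ j" for s
      using j E[of s] by (simp add: y_def del: index_mult_mat_vec)
    ultimately show ?thesis by simp
  qed
  have "\<bar>(mat_exp (t \<cdot>\<^sub>m A) *\<^sub>v v) $ i\<bar> \<le> max_norm v" if i: "i < n" for i
  proof -
    have z: "(mat_exp ((t - s) \<cdot>\<^sub>m B) *\<^sub>v (B *\<^sub>v y s - B *\<^sub>v y s)) $ i = 0" for s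
    proof -
      have "B *\<^sub>v y s - B *\<^sub>v y s = 0\<^sub>v n" using cB y by auto
      then show ?thesis using EB[of "t - s"] i by auto
    qed
    \<comment> \<open>Comparing this constant function at \<open>s = 0\<close> and
      \<open>s = t\<close> gives \<open>exp (t B) v = y t\<close>, without a product formula for
      matrix exponentials.\<close>
    have "((\<lambda>s. (mat_exp ((t - s) \<cdot>\<^sub>m B) *\<^sub>v y s) $ i) has_real_derivative 0) (at s within {0..t})"
      if "s \<in> {0..t}" for s
    proof -
      have "((\<lambda>s. (mat_exp ((t - s) \<cdot>\<^sub>m B) *\<^sub>v y s) $ i) has_real_derivative
          (mat_exp ((t - s) \<cdot>\<^sub>m B) *\<^sub>v (B *\<^sub>v y s - B *\<^sub>v y s)) $ i) (at s within {0..t})"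
        by (rule mat_exp_diff_mult_has_derivative[OF cB i that y mult_mat_vec_carrier[OF cB y] dy])
      then show ?thesis unfolding z .
    qed
    from has_field_derivative_zero_constant[OF convex_real_interval(5) this]
    obtain d where d: "\<And>s. s \<in> {0..t} \<Longrightarrow> (mat_exp ((t - s) \<cdot>\<^sub>m B) *\<^sub>v y s) $ i = d"
      by blast
    have "y 0 = v"
      using mat_exp_zero_smult[OF cA] v by (simp add: y_def)
    moreover have "mat_exp ((t - t) \<cdot>\<^sub>m B) *\<^sub>v y t = y t"
      using mat_exp_zero_smult[OF cB] y by simp
    ultimately have "(mat_exp (t \<cdot>\<^sub>m B) *\<^sub>v v) $ i = y t $ i"
      using d[of 0] d[of t] t by (simp del: index_mult_mat_vec)
    also have "\<dots> = exp (c * t) * (mat_exp (t \<cdot>\<^sub>m A) *\<^sub>v v) $ i"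
      using i E[of t] by (simp add: y_def del: index_mult_mat_vec)
    finally have "exp (c * t) * \<bar>(mat_exp (t \<cdot>\<^sub>m A) *\<^sub>v v) $ i\<bar> = \<bar>(mat_exp (t \<cdot>\<^sub>m B) *\<^sub>v v) $ i\<bar>"
      by (simp add: abs_mult)
    also have "\<dots> \<le> max_norm (mat_exp (t \<cdot>\<^sub>m B) *\<^sub>v v)"
      using i EB[of t] by (intro abs_vec_index_le_max_norm) auto
    also have "\<dots> \<le> exp (c * t) * max_norm v"
      using le v by (intro mat_exp_norm_le[OF cB n c t]) (auto simp: B_def)
    finally show ?thesis by simp
  qed
  then show ?thesis
    using n E[of t] by (subst max_norm_le_iff) auto
qed

text \<open>Derivatives and mean value estimates are taken one coordinate at a time, so the
  contraction is needed in this form.\<close>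

lemma rate_matrix_mat_exp_index_le:
  assumes "rate_matrix n A" "0 < n" "0 \<le> t" and v: "v \<in> carrier_vec n" and "i < n"
    and "\<And>j. j < n \<Longrightarrow> \<bar>v $ j\<bar> \<le> c"
  shows "\<bar>(mat_exp (t \<cdot>\<^sub>m A) *\<^sub>v v) $ i\<bar> \<le> c"
proof -
  have "\<bar>(mat_exp (t \<cdot>\<^sub>m A) *\<^sub>v v) $ i\<bar> \<le> max_norm (mat_exp (t \<cdot>\<^sub>m A) *\<^sub>v v)"
    using assms by (intro abs_vec_index_le_max_norm) (auto simp: rate_matrix_def mat_exp_def)
  also have "\<dots> \<le> max_norm v"
    by (rule rate_matrix_mat_exp_contraction[OF assms(1-4)])
  also have "\<dots> \<le> c"
    using assms by (subst max_norm_le_iff) auto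
  finally show ?thesis .
qed

text \<open>The derivative \<open>exp (r A) (A v)\<close> is bounded by the norm of
  \<open>A v\<close> because of the contraction; the mean value inequality over a length
  \<open>s\<close> gives the estimate.\<close>

lemma rate_matrix_mat_exp_diff_le:
  assumes A: "rate_matrix n A" and n: "0 < n" and s: "0 \<le> s" "s \<le> t" and v: "v \<in> carrier_vec n"
    and i: "i < n"
  shows "\<bar>(mat_exp ((t - s) \<cdot>\<^sub>m A) *\<^sub>v v) $ i - (mat_exp (t \<cdot>\<^sub>m A) *\<^sub>v v) $ i\<bar> \<le> s * max_norm (A *\<^sub>v v)"
proof -
  have cA: "A \<in> carrier_mat n n" using A by (simp add: rate_matrix_def)
  have "norm ((mat_exp (s' \<cdot>\<^sub>m A) *\<^sub>v (A *\<^sub>v v)) $ i) \<le> max_norm (A *\<^sub>v v)" if "s' \<in> {0..t}" for s'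
    unfolding real_norm_def using cA v that i
    by (intro rate_matrix_mat_exp_index_le[OF A n] abs_vec_index_le_max_norm) auto
  then have "norm ((mat_exp ((t - s) \<cdot>\<^sub>m A) *\<^sub>v v) $ i - (mat_exp (t \<cdot>\<^sub>m A) *\<^sub>v v) $ i)
      \<le> max_norm (A *\<^sub>v v) * norm ((t - s) - t)"
    using s mat_exp_mult_vec_has_derivative[OF cA v i]
    by (intro field_differentiable_bound[where S = "{0..t}" and f = "\<lambda>r. (mat_exp (r \<cdot>\<^sub>m A) *\<^sub>v v) $ i"
          and f' = "\<lambda>r. (mat_exp (r \<cdot>\<^sub>m A) *\<^sub>v (A *\<^sub>v v)) $ i"]) (blast, blast, blast, simp, simp)
  then show ?thesis
    using s by (simp add: mult_ac del: index_mult_mat_vec)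
qed

lemma rate_matrix_add: "rate_matrix n A \<Longrightarrow> rate_matrix n B \<Longrightarrow> rate_matrix n (A + B)"
  by (auto simp: rate_matrix_def sum.distrib)

lemma rate_matrix_smult: "0 \<le> c \<Longrightarrow> rate_matrix n A \<Longrightarrow> rate_matrix n (c \<cdot>\<^sub>m A)"
  by (auto simp: rate_matrix_def sum_distrib_left[symmetric])

subsection \<open>The discrete Laplacian\<close>

text \<open>Cutting the index range into \<open>p\<close> blocks of length \<open>q\<close> makes
  the quotient constant on each block while the remainder runs through all values.\<close>

lemma sum_div_mod_product:
  fixes a b :: "nat \<Rightarrow> real"
  shows "(\<Sum>j<p * q. a (j div q) * b (j mod q)) = (\<Sum>k<p. a k) * (\<Sum>l<q. b l)"
proof (cases "q = 0")
  case False
  have "(\<Sum>j<p * q. a (j div q) * b (j mod q)) = (\<Sum>k<p. \<Sum>j\<in>{k * q..<k * q + q}. a (j div q) * b (j mod q))"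
    by (rule sum.nat_group[symmetric])
  also have "\<dots> = (\<Sum>k<p. \<Sum>l<q. a k * b l)"
  proof (rule sum.cong[OF refl])
    fix k
    have "(\<Sum>j\<in>{0 + k * q..<q + k * q}. a (j div q) * b (j mod q)) =
        (\<Sum>l\<in>{0..<q}. a ((l + k * q) div q) * b ((l + k * q) mod q))"
      by (rule sum.shift_bounds_nat_ivl)
    also have "\<dots> = (\<Sum>l<q. a k * b l)"
      using False by (intro sum.cong) auto
    finally show "(\<Sum>j\<in>{k * q..<k * q + q}. a (j div q) * b (j mod q)) = (\<Sum>l<q. a k * b l)"
      by (simp add: add.commute)
  qed
  finally show ?thesis
    by (simp add: sum_product)
qed simp

section \<open>Rate matrices built by Kronecker products\<close>

lemma kronecker_carrier:
  "A \<in> carrier_mat m n \<Longrightarrow> B \<in> carrier_mat p q \<Longrightarrow> A \<otimes>\<^sub>K B \<in> carrier_mat (m * p) (n * q)"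
  by (auto simp: kronecker_def)

lemma kronecker_index:
  "A \<in> carrier_mat m n \<Longrightarrow> B \<in> carrier_mat p q \<Longrightarrow> i < m * p \<Longrightarrow> j < n * q \<Longrightarrow>
    (A \<otimes>\<^sub>K B) $$ (i, j) = A $$ (i div p, j div q) * B $$ (i mod p, j mod q)"
  by (auto simp: kronecker_def)

lemma mod_less_of_less_mult: "(i :: nat) < p * q \<Longrightarrow> i mod q < q"
  by (cases "q = 0") auto

text \<open>Row sums factor, and one factor is zero. A negative diagonal entry of the rate factor
  cannot appear off the diagonal: there the indices of the identity factor differ, so the product
  vanishes.\<close>

lemma rate_matrix_kronecker:
  assumes A: "A \<in> carrier_mat p p" and B: "B \<in> carrier_mat q q"
    and cases: "A = 1\<^sub>m p \<and> rate_matrix q B \<or> rate_matrix p A \<and> B = 1\<^sub>m q"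
  shows "rate_matrix (p * q) (A \<otimes>\<^sub>K B)"
  unfolding rate_matrix_def
proof (intro conjI allI impI)
  show "A \<otimes>\<^sub>K B \<in> carrier_mat (p * q) (p * q)"
    using A B by (rule kronecker_carrier)
next
  fix i j assume ij: "i < p * q" "j < p * q" "i \<noteq> j"
  then have "i div q \<noteq> j div q \<or> i mod q \<noteq> j mod q"
    by (metis div_mult_mod_eq)
  then show "0 \<le> (A \<otimes>\<^sub>K B) $$ (i, j)"
    using cases ij by (auto simp: kronecker_index[OF A B] rate_matrix_def less_mult_imp_div_less mod_less_of_less_mult)
next
  fix i assume i: "i < p * q"
  have "(\<Sum>j<p * q. (A \<otimes>\<^sub>K B) $$ (i, j)) =
      (\<Sum>k<p. A $$ (i div q, k)) * (\<Sum>l<q. B $$ (i mod q, l))"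
    using i by (simp add: kronecker_index[OF A B]
      sum_div_mod_product[of "\<lambda>k. A $$ (i div q, k)" q "\<lambda>l. B $$ (i mod q, l)" p])
  also have "\<dots> = 0"
    using cases i by (auto simp: rate_matrix_def less_mult_imp_div_less mod_less_of_less_mult)
  finally show "(\<Sum>j<p * q. (A \<otimes>\<^sub>K B) $$ (i, j)) = 0" .
qed

lemma rate_matrix_one_kronecker: "rate_matrix q B \<Longrightarrow> rate_matrix (p * q) (1\<^sub>m p \<otimes>\<^sub>K B)"
  by (rule rate_matrix_kronecker) (auto simp: rate_matrix_def)

lemma rate_matrix_kronecker_one: "rate_matrix p A \<Longrightarrow> rate_matrix (p * q) (A \<otimes>\<^sub>K 1\<^sub>m q)"
  by (rule rate_matrix_kronecker) (auto simp: rate_matrix_def)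

text \<open>As the product associates to the left, the first term in dimension three starts with two
  identity factors, which are merged into one.\<close>

lemma one_kronecker_one: "1\<^sub>m p \<otimes>\<^sub>K 1\<^sub>m q = 1\<^sub>m (p * q)"
proof (rule eq_matI)
  fix i j assume "i < dim_row (1\<^sub>m (p * q) :: real mat)" "j < dim_col (1\<^sub>m (p * q) :: real mat)"
  then have ij: "i < p * q" "j < p * q" by auto
  moreover have "i = j \<longleftrightarrow> i div q = j div q \<and> i mod q = j mod q"
    by (metis div_mult_mod_eq)
  ultimately show "(1\<^sub>m p \<otimes>\<^sub>K 1\<^sub>m q) $$ (i, j) = 1\<^sub>m (p * q) $$ (i, j)"
    by (auto simp: kronecker_index[of _ p p _ q q] less_mult_imp_div_less mod_less_of_less_mult)
qed (auto simp: kronecker_def)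

lemma rate_matrix_neumann:
  assumes n: "2 \<le> n"
  shows "rate_matrix n (neumann_matrix h n)"
  unfolding neumann_matrix_def
proof (rule rate_matrix_smult, simp, unfold rate_matrix_def, intro conjI allI impI)
  let ?M = "mat n n (\<lambda>(i, j). if i = j then - 2
     else if (i = 0 \<and> j = 1) \<or> (i + 1 = n \<and> j + 2 = n) then 2
     else if j = i + 1 \<or> i = j + 1 then 1 else 0) :: real mat"
  show "?M \<in> carrier_mat n n" by simp
  show "0 \<le> ?M $$ (i, j)" if "i < n" "j < n" "i \<noteq> j" for i j
    using that by auto
  fix i assume i: "i < n"
  \<comment> \<open>A row is supported on a point and its neighbours; the doubled boundary entry
    makes up for the neighbour outside the grid.\<close>
  have "(\<Sum>j<n. ?M $$ (i, j)) = (\<Sum>j \<in> {i - 1, i, i + 1} \<inter> {..<n}. ?M $$ (i, j))"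
    using i by (intro sum.mono_neutral_right) auto
  also have "\<dots> = 0"
  proof -
    consider "i = 0" | "0 < i" "i + 1 = n" | "0 < i" "i + 1 < n"
      using i by linarith
    then show ?thesis
    proof cases
      case 1
      \<comment> \<open>Natural subtraction gives \<open>i - 1 = 0\<close> here, so only two indices
        remain.\<close>
      then have "{i - 1, i, i + 1} \<inter> {..<n} = {0, 1}" using n by auto
      then show ?thesis using 1 n by simp
    next
      case 2
      then have "{i - 1, i, i + 1} \<inter> {..<n} = {i - 1, i}" using n by auto
      then show ?thesis using 2 n by simp
    next
      case 3
      then obtain k where k: "i = Suc k" by (cases i) auto
      then have "{i - 1, i, i + 1} \<inter> {..<n} = {k, Suc k, Suc (Suc k)}" using 3 by auto
      then show ?thesis using 3 k by simp
    qed
  qed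
  finally show "(\<Sum>j<n. ?M $$ (i, j)) = 0" .
qed

lemma rate_matrix_system_matrix:
  assumes len: "length ns \<in> {1, 2, 3}" and ns: "\<forall>n\<in>set ns. 2 \<le> n"
  shows "rate_matrix (prod_list ns) (system_matrix \<epsilon> h ns)"
proof -
  have "rate_matrix (prod_list ns) (discrete_laplacian h ns)"
  proof -
    consider (1) a where "ns = [a]" | (2) a b where "ns = [a, b]" | (3) a b c where "ns = [a, b, c]"
      using len by (auto simp: length_Suc_conv eval_nat_numeral)
    then show ?thesis
    proof cases
      case 1
      then show ?thesis using ns by (simp add: rate_matrix_neumann)
    next
      case 2
      then have "rate_matrix (b * a) (1\<^sub>m b \<otimes>\<^sub>K neumann_matrix h a + neumann_matrix h b \<otimes>\<^sub>K 1\<^sub>m a)"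
        using ns by (intro rate_matrix_add rate_matrix_one_kronecker rate_matrix_kronecker_one rate_matrix_neumann) auto
      \<comment> \<open>Since the first coordinate varies fastest, the Kronecker factors come in
        reverse order and the size \<open>b * a\<close> must be matched with
        \<open>prod_list ns\<close>.\<close>
      then show ?thesis using 2 by (simp add: mult.commute)
    next
      case 3
      then have "rate_matrix (c * b * a) (1\<^sub>m c \<otimes>\<^sub>K 1\<^sub>m b \<otimes>\<^sub>K neumann_matrix h a +
         1\<^sub>m c \<otimes>\<^sub>K neumann_matrix h b \<otimes>\<^sub>K 1\<^sub>m a + neumann_matrix h c \<otimes>\<^sub>K 1\<^sub>m b \<otimes>\<^sub>K 1\<^sub>m a)"
        using ns unfolding one_kronecker_one
        by (intro rate_matrix_add rate_matrix_one_kronecker rate_matrix_kronecker_one rate_matrix_neumann) auto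
      then show ?thesis using 3 by (simp add: ac_simps)
    qed
  qed
  then show ?thesis
    unfolding system_matrix_def by (intro rate_matrix_smult) auto
qed

subsection \<open>The nonlinearity and the step size restriction\<close>

lemma abs_le_max_abs:
  assumes "continuous_on {-\<beta>..\<beta>} g" "x \<in> {-\<beta>..\<beta>}"
  shows "\<bar>g x\<bar> \<le> max_abs g \<beta>"
  unfolding max_abs_def
proof (rule cSUP_upper[OF assms(2)])
  have "compact ((\<lambda>x. \<bar>g x\<bar>) ` {-\<beta>..\<beta>})"
    by (rule compact_continuous_image[OF continuous_on_rabs[OF assms(1)] compact_Icc])
  then show "bdd_above ((\<lambda>x. \<bar>g x\<bar>) ` {-\<beta>..\<beta>})"
    by (intro bounded_imp_bdd_above compact_imp_bounded)
qed

lemma C1_on_with_deriv_continuous: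
  assumes "C1_on_with_deriv S f f'"
  shows "continuous_on S f"
proof (rule DERIV_continuous_on)
  show "(f has_real_derivative f' x) (at x within S)" if "x \<in> S" for x
    using assms that by (simp add: C1_on_with_deriv_def)
qed

lemma C1_on_with_deriv_lipschitz:
  assumes C1: "C1_on_with_deriv {-\<beta>..\<beta>} f f'" and xy: "x \<in> {-\<beta>..\<beta>}" "y \<in> {-\<beta>..\<beta>}"
  shows "\<bar>f x - f y\<bar> \<le> max_abs f' \<beta> * \<bar>x - y\<bar>"
proof -
  have "(f has_real_derivative f' z) (at z within {-\<beta>..\<beta>})" "norm (f' z) \<le> max_abs f' \<beta>"
    if "z \<in> {-\<beta>..\<beta>}" for z
    using C1 that abs_le_max_abs[of \<beta> f' z] by (simp_all add: C1_on_with_deriv_def)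
  from field_differentiable_bound[OF convex_real_interval(5) this xy] show ?thesis
    unfolding real_norm_def .
qed

text \<open>A positive step below \<^const>\<open>omega0\<close> forces the infimum of \<open>f'\<close> to be negative, since the
  quotient in \<^const>\<open>omega0\<close> is \<open>0\<close> when the infimum is \<open>0\<close>.\<close>

lemma step_le_omega0_imp:
  assumes C1: "C1_on_with_deriv {-\<beta>..\<beta>} f f'" and \<tau>: "0 < \<tau>" "\<tau> \<le> omega0 f' \<beta>" and \<beta>: "0 < \<beta>"
  shows "0 < max_abs f' \<beta>" and "\<And>x. x \<in> {-\<beta>..\<beta>} \<Longrightarrow> - 1 \<le> \<tau> * f' x"
proof -
  define m where "m = (INF x\<in>{-\<beta>..\<beta>}. f' x)"
  have cont: "continuous_on {-\<beta>..\<beta>} f'" using C1 by (simp add: C1_on_with_deriv_def)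
  have "compact (f' ` {-\<beta>..\<beta>})"
    using cont by (intro compact_continuous_image) auto
  then have "bdd_below (f' ` {-\<beta>..\<beta>})"
    by (intro bounded_imp_bdd_below compact_imp_bounded)
  then have m: "m \<le> f' x" if "x \<in> {-\<beta>..\<beta>}" for x
    unfolding m_def using that by (rule cINF_lower)
  have le: "\<tau> \<le> - 1 / m"
    using \<tau>(2) by (simp add: omega0_def m_def)
  then have "0 < - 1 / m"
    using \<tau>(1) by linarith
  then have neg: "m < 0"
    by (simp add: divide_less_0_iff)
  show "- 1 \<le> \<tau> * f' x" if "x \<in> {-\<beta>..\<beta>}" for x
  proof -
    \<comment> \<open>Multiplying \<open>\<tau> \<le> - 1 / m\<close> by the negative number
      \<open>m\<close> reverses the inequality.\<close>
    have "- 1 \<le> \<tau> * m" using le neg by (simp add: field_simps)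
    also have "\<dots> \<le> \<tau> * f' x" using \<tau> m[OF that] by (intro mult_left_mono) auto
    finally show ?thesis .
  qed
  show "0 < max_abs f' \<beta>"
  proof (rule ccontr)
    \<comment> \<open>Otherwise \<open>f'\<close> would vanish on the whole interval and its infimum
      would be zero instead of negative.\<close>
    assume "\<not> 0 < max_abs f' \<beta>"
    then have "f' x = 0" if "x \<in> {-\<beta>..\<beta>}" for x
      using abs_le_max_abs[OF cont that] by auto
    then have "f' ` {-\<beta>..\<beta>} = {0}"
      using \<beta> by force
    then show False using neg by (simp add: m_def)
  qed
qed

text \<open>Since \<open>1 + \<tau> * f' x\<close> is nonnegative, the explicit Euler map is
  monotone and extremal at the end points, where the signs of \<open>f\<close> point inward.\<close>

lemma explicit_step_bound:
  assumes C1: "C1_on_with_deriv {-\<beta>..\<beta>} f f'" and f: "f \<beta> \<le> 0" "0 \<le> f (- \<beta>)"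
    and \<tau>: "0 < \<tau>" "\<And>x. x \<in> {-\<beta>..\<beta>} \<Longrightarrow> - 1 \<le> \<tau> * f' x" and x: "x \<in> {-\<beta>..\<beta>}"
  shows "\<bar>x + \<tau> * f x\<bar> \<le> \<beta>"
proof -
  have mono: "a + \<tau> * f a \<le> b + \<tau> * f b" if ab: "a \<in> {-\<beta>..\<beta>}" "b \<in> {-\<beta>..\<beta>}" "a \<le> b" for a b
  proof -
    \<comment> \<open>This mean value theorem asks for derivatives within \<open>{a..b}\<close>
      only, so one-sided derivatives at \<open>- \<beta>\<close> and \<open>\<beta>\<close>
      suffice.\<close>
    have "\<exists>\<xi>\<in>{a..b}. f b - f a = (*) (f' \<xi>) (b - a)"
    proof (rule mvt_very_simple[OF ab(3)])
      fix y assume "a \<le> y" "y \<le> b"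
      then have "(f has_real_derivative f' y) (at y within {-\<beta>..\<beta>})"
        using C1 ab by (simp add: C1_on_with_deriv_def)
      then show "(f has_derivative (*) (f' y)) (at y within {a..b})"
        using ab by (auto simp: has_field_derivative_def intro: has_derivative_subset)
    qed
    then obtain \<xi> where \<xi>: "\<xi> \<in> {a..b}" "f b - f a = f' \<xi> * (b - a)" by auto
    have "- 1 * (b - a) \<le> \<tau> * f' \<xi> * (b - a)"
      using \<tau>(2)[of \<xi>] \<xi> ab by (intro mult_right_mono) auto
    also have "\<dots> = \<tau> * (f b - f a)" using \<xi>(2) by simp
    finally show ?thesis by (simp add: algebra_simps)
  qed
  have "x + \<tau> * f x \<le> \<beta> + \<tau> * f \<beta>" "- \<beta> + \<tau> * f (- \<beta>) \<le> x + \<tau> * f x"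
    using mono[of x \<beta>] mono[of "- \<beta>" x] x by auto
  moreover have "\<tau> * f \<beta> \<le> 0" "0 \<le> \<tau> * f (- \<beta>)"
    using f \<tau>(1) by (auto simp: mult_nonneg_nonpos)
  ultimately show ?thesis by (simp add: abs_le_iff)
qed

subsection \<open>Error analysis\<close>

text \<open>The initial value is written \<open>u 0\<close>, which keeps the grid and the initial
  function out of the error analysis; the discretization enters through the rate property.\<close>

locale semilinear_rate_system =
  fixes A :: "real mat" and n :: nat and f f' :: "real \<Rightarrow> real" and \<beta> T :: real and u :: "real \<Rightarrow> real vec"
  assumes rate: "rate_matrix n A" and n: "0 < n" and \<beta>: "0 < \<beta>" and T: "0 < T"
    and C1: "C1_on_with_deriv {-\<beta>..\<beta>} f f'"
    and solution: "exact_solution A f T (u 0) u"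
    and bounded: "\<And>t. t \<in> {0..T} \<Longrightarrow> max_norm (u t) \<le> \<beta>"
begin

abbreviation "E t \<equiv> mat_exp (t \<cdot>\<^sub>m A)"
abbreviation "F0 \<equiv> max_abs f \<beta>"
abbreviation "F1 \<equiv> max_abs f' \<beta>"
abbreviation "a \<equiv> mat_max_norm A"

text \<open>The first summand measures how \<open>f\<close> changes along the solution, whose speed
  is at most \<open>a * \<beta> + F0\<close>; the second measures how the exponential changes when
  applied to a vector of norm at most \<open>F0\<close>.\<close>

definition "L = F1 * (a * \<beta> + F0) + a * F0"

lemma A_carrier: "A \<in> carrier_mat n n"
  using rate by (simp add: rate_matrix_def)

lemma E_carrier: "E t \<in> carrier_mat n n"
  using A_carrier by (intro mat_exp_carrier) auto

lemma u_carrier: "t \<in> {0..T} \<Longrightarrow> u t \<in> carrier_vec n"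
  using solution A_carrier unfolding exact_solution_def by simp

lemma f_u_carrier: "t \<in> {0..T} \<Longrightarrow> map_vec f (u t) \<in> carrier_vec n"
  by (rule map_carrier_vec[THEN iffD2, OF u_carrier])

lemma index_in_interval: "v \<in> carrier_vec n \<Longrightarrow> max_norm v \<le> \<beta> \<Longrightarrow> i < n \<Longrightarrow> v $ i \<in> {-\<beta>..\<beta>}"
  using abs_vec_index_le_max_norm[of i v] by (auto simp: abs_le_iff)

lemma u_index: "t \<in> {0..T} \<Longrightarrow> i < n \<Longrightarrow> u t $ i \<in> {-\<beta>..\<beta>}"
  by (rule index_in_interval[OF u_carrier bounded])

lemma F0: "x \<in> {-\<beta>..\<beta>} \<Longrightarrow> \<bar>f x\<bar> \<le> F0"
  by (intro abs_le_max_abs C1_on_with_deriv_continuous[OF C1])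

lemma F1_nonneg: "0 \<le> F1"
proof -
  have "\<bar>f' 0\<bar> \<le> F1"
    using C1 \<beta> by (intro abs_le_max_abs) (auto simp: C1_on_with_deriv_def)
  then show ?thesis by linarith
qed

lemma a_nonneg: "0 \<le> a"
  using mat_max_norm_nonneg[OF A_carrier n n] .

lemma F0_nonneg: "0 \<le> F0"
  using F0[of 0] \<beta> by simp

lemma max_norm_f_u_le: "t \<in> {0..T} \<Longrightarrow> max_norm (map_vec f (u t)) \<le> F0"
  using u_carrier[of t] n F0 u_index by (subst max_norm_le_iff) auto

lemma max_norm_A_le: "v \<in> carrier_vec n \<Longrightarrow> max_norm v \<le> c \<Longrightarrow> max_norm (A *\<^sub>v v) \<le> a * c"
  by (rule order_trans[OF max_norm_mult_mat_vec_le[OF A_carrier n n] mult_left_mono[OF _ a_nonneg]])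

section \<open>Regularity of the exact solution, consistency and stability of one step\<close>

lemma u_has_derivative:
  "t \<in> {0..T} \<Longrightarrow> i < n \<Longrightarrow>
    ((\<lambda>s. u s $ i) has_real_derivative (A *\<^sub>v u t + map_vec f (u t)) $ i) (at t within {0..T})"
  using solution A_carrier unfolding exact_solution_def by (metis carrier_matD(1))

lemma u_lipschitz:
  assumes "s \<in> {0..T}" "t \<in> {0..T}" and i: "i < n"
  shows "\<bar>u s $ i - u t $ i\<bar> \<le> (a * \<beta> + F0) * \<bar>s - t\<bar>"
proof -
  have "norm ((A *\<^sub>v u r + map_vec f (u r)) $ i) \<le> a * \<beta> + F0" if r: "r \<in> {0..T}" for r
  proof -
    have "\<bar>(A *\<^sub>v u r) $ i\<bar> \<le> a * \<beta>"
      using abs_vec_index_le_max_norm[of i "A *\<^sub>v u r"] max_norm_A_le[OF u_carrier bounded, OF r r] i A_carrier by auto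
    moreover have "\<bar>map_vec f (u r) $ i\<bar> \<le> F0"
      using F0[OF u_index[OF r i]] u_carrier[OF r] i by simp
    moreover have "(A *\<^sub>v u r + map_vec f (u r)) $ i = (A *\<^sub>v u r) $ i + map_vec f (u r) $ i"
      using f_u_carrier[OF r] i by (subst index_add_vec) auto
    ultimately show ?thesis by (simp del: index_mult_mat_vec)
  qed
  then have "norm (u s $ i - u t $ i) \<le> (a * \<beta> + F0) * norm (s - t)"
    using assms u_has_derivative
    by (intro field_differentiable_bound[where S = "{0..T}" and f = "\<lambda>s. u s $ i"
          and f' = "\<lambda>r. (A *\<^sub>v u r + map_vec f (u r)) $ i"]) blast+
  then show ?thesis by simp
qed

text \<open>The scheme replaces the slope \<open>E (\<tau> - r) f(u(t + r))\<close> by its value at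
  \<open>r = 0\<close>. The slopes differ by at most \<open>L * r\<close>, hence by
  \<open>L * \<tau>\<close>, and acting over a length \<open>\<tau>\<close> this gives the
  square.\<close>

lemma local_error:
  assumes t: "0 \<le> t" and \<tau>: "0 \<le> \<tau>" "t + \<tau> \<le> T" and i: "i < n"
  shows "\<bar>u (t + \<tau>) $ i - (E \<tau> *\<^sub>v (u t + \<tau> \<cdot>\<^sub>v map_vec f (u t))) $ i\<bar> \<le> L * \<tau>\<^sup>2"
proof -
  let ?f = "\<lambda>r. map_vec f (u (t + r))"
  have tr: "t + r \<in> {0..T}" if "r \<in> {0..\<tau>}" for r using that t \<tau> by auto
  have t0: "t \<in> {0..T}" using t \<tau> by auto
  \<comment> \<open>The increment of \<open>g\<close> over \<open>{0..\<tau>}\<close> is exactly the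
    local error, and its derivative is the difference of the two slopes.\<close>
  define g where "g = (\<lambda>r. (E (\<tau> - r) *\<^sub>v u (t + r)) $ i - r * (E \<tau> *\<^sub>v ?f 0) $ i)"
  have dg: "(g has_real_derivative (E (\<tau> - r) *\<^sub>v ?f r) $ i - (E \<tau> *\<^sub>v ?f 0) $ i) (at r within {0..\<tau>})"
    if r: "r \<in> {0..\<tau>}" for r
  proof -
    have "((\<lambda>s. u (t + s) $ j) has_real_derivative (A *\<^sub>v u (t + r) + ?f r) $ j) (at r within {0..\<tau>})"
      if j: "j < n" for j
    proof -
      have "((\<lambda>s. u s $ j) has_real_derivative (A *\<^sub>v u (t + r) + ?f r) $ j) (at (t + r) within (+) t ` {0..\<tau>})"
        using t \<tau> by (intro DERIV_subset[OF u_has_derivative[OF tr[OF r] j]]) auto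
      then show ?thesis by (rule DERIV_at_within_shift[THEN iffD1])
    qed
    then have "((\<lambda>s. (E (\<tau> - s) *\<^sub>v u (t + s)) $ i) has_real_derivative
      (E (\<tau> - r) *\<^sub>v ((A *\<^sub>v u (t + r) + ?f r) - A *\<^sub>v u (t + r))) $ i) (at r within {0..\<tau>})"
      using tr r u_carrier f_u_carrier A_carrier i
      by (intro mat_exp_diff_mult_has_derivative[OF A_carrier i r]) auto
    \<comment> \<open>The stiff term cancels here, so only the nonlinearity drives
      \<open>g\<close>.\<close>
    moreover have "(A *\<^sub>v u (t + r) + ?f r) - A *\<^sub>v u (t + r) = ?f r"
      using f_u_carrier[OF tr[OF r]] A_carrier by (intro eq_vecI) auto
    moreover have "((\<lambda>s. s * c) has_real_derivative c) (at r within {0..\<tau>})" for c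
      by (auto intro!: derivative_eq_intros)
    ultimately show ?thesis
      unfolding g_def by (simp only: DERIV_diff)
  qed
  have bg: "norm ((E (\<tau> - r) *\<^sub>v ?f r) $ i - (E \<tau> *\<^sub>v ?f 0) $ i) \<le> L * \<tau>" if r: "r \<in> {0..\<tau>}" for r
  proof -
    note c = f_u_carrier[OF tr[OF r]] f_u_carrier[OF t0]
    \<comment> \<open>First the argument of \<open>f\<close> is frozen and then the exponential,
      giving the two summands of \<open>L\<close>.\<close>
    have "(E (\<tau> - r) *\<^sub>v ?f r) $ i - (E \<tau> *\<^sub>v ?f 0) $ i =
        (E (\<tau> - r) *\<^sub>v (?f r - ?f 0)) $ i + ((E (\<tau> - r) *\<^sub>v ?f 0) $ i - (E \<tau> *\<^sub>v ?f 0) $ i)"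
      using c i E_carrier[of "\<tau> - r"] E_carrier[of \<tau>]
      by (simp add: mult_minus_distrib_mat_vec[of _ n n] del: index_mult_mat_vec)
    moreover have "\<bar>(E (\<tau> - r) *\<^sub>v (?f r - ?f 0)) $ i\<bar> \<le> F1 * ((a * \<beta> + F0) * r)"
    proof (rule rate_matrix_mat_exp_index_le[OF rate n _ _ i])
      fix j assume j: "j < n"
      have "\<bar>f (u (t + r) $ j) - f (u t $ j)\<bar> \<le> F1 * \<bar>u (t + r) $ j - u t $ j\<bar>"
        using tr r t0 j by (intro C1_on_with_deriv_lipschitz[OF C1] u_index)
      also have "\<dots> \<le> F1 * ((a * \<beta> + F0) * r)"
        using u_lipschitz[OF tr[OF r] t0 j] r F1_nonneg by (intro mult_left_mono) auto
      finally show "\<bar>(?f r - ?f 0) $ j\<bar> \<le> F1 * ((a * \<beta> + F0) * r)"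
        using j u_carrier[OF tr[OF r]] u_carrier[OF t0] by simp
    qed (use r c in auto)
    moreover have "\<bar>(E (\<tau> - r) *\<^sub>v ?f 0) $ i - (E \<tau> *\<^sub>v ?f 0) $ i\<bar> \<le> r * (a * F0)"
    proof -
      have "\<bar>(E (\<tau> - r) *\<^sub>v ?f 0) $ i - (E \<tau> *\<^sub>v ?f 0) $ i\<bar> \<le> r * max_norm (A *\<^sub>v ?f 0)"
        using c r i by (intro rate_matrix_mat_exp_diff_le[OF rate n]) auto
      also have "\<dots> \<le> r * (a * F0)"
        using c r max_norm_f_u_le[OF t0] by (intro mult_left_mono max_norm_A_le) auto
      finally show ?thesis .
    qed
    ultimately have "norm ((E (\<tau> - r) *\<^sub>v ?f r) $ i - (E \<tau> *\<^sub>v ?f 0) $ i) \<le> L * r"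
      unfolding L_def real_norm_def by (simp add: algebra_simps del: index_mult_mat_vec)
    also have "\<dots> \<le> L * \<tau>"
      using r F0_nonneg F1_nonneg a_nonneg \<beta> by (intro mult_left_mono) (auto simp: L_def)
    finally show ?thesis .
  qed
  have "norm (g \<tau> - g 0) \<le> L * \<tau> * norm (\<tau> - 0)"
    using \<tau> by (intro field_differentiable_bound[where S = "{0..\<tau>}" and f = g
          and f' = "\<lambda>r. (E (\<tau> - r) *\<^sub>v ?f r) $ i - (E \<tau> *\<^sub>v ?f 0) $ i"] dg bg) auto
  moreover have "g \<tau> - g 0 = u (t + \<tau>) $ i - (E \<tau> *\<^sub>v (u t + \<tau> \<cdot>\<^sub>v map_vec f (u t))) $ i"
  proof -
    have "E \<tau> *\<^sub>v (u t + \<tau> \<cdot>\<^sub>v ?f 0) = E \<tau> *\<^sub>v u t + \<tau> \<cdot>\<^sub>v (E \<tau> *\<^sub>v ?f 0)"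
      using E_carrier[of \<tau>] u_carrier[OF t0] f_u_carrier[OF t0]
      by (simp add: mult_add_distrib_mat_vec[of _ n n] mult_mat_vec[of _ n n])
    moreover have "E (\<tau> - \<tau>) *\<^sub>v u (t + \<tau>) = u (t + \<tau>)"
      using u_carrier[OF tr[of \<tau>]] \<tau> mat_exp_zero_smult[OF A_carrier] by simp
    ultimately show ?thesis
      using i E_carrier[of \<tau>] by (simp add: g_def del: index_mult_mat_vec)
  qed
  ultimately show ?thesis
    using \<tau> by (simp add: power2_eq_square mult_ac del: index_mult_mat_vec)
qed

text \<open>The exponential contracts, so only the Euler map can enlarge differences. Both vectors
  must lie in the range where \<open>f\<close> has Lipschitz constant \<open>F1\<close>.\<close>

lemma step_stable:
  assumes \<tau>: "0 \<le> \<tau>" and v: "v \<in> carrier_vec n" "max_norm v \<le> \<beta>"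
    and w: "w \<in> carrier_vec n" "max_norm w \<le> \<beta>"
    and le: "max_norm (v - w) \<le> e" and i: "i < n"
  shows "\<bar>(E \<tau> *\<^sub>v (v + \<tau> \<cdot>\<^sub>v map_vec f v)) $ i - (E \<tau> *\<^sub>v (w + \<tau> \<cdot>\<^sub>v map_vec f w)) $ i\<bar> \<le> (1 + \<tau> * F1) * e"
proof -
  let ?g = "\<lambda>v. v + \<tau> \<cdot>\<^sub>v map_vec f v"
  have c: "?g v \<in> carrier_vec n" "?g w \<in> carrier_vec n"
    using v w by auto
  have "E \<tau> *\<^sub>v (?g v - ?g w) = E \<tau> *\<^sub>v ?g v - E \<tau> *\<^sub>v ?g w"
    by (rule mult_minus_distrib_mat_vec[OF E_carrier c])
  then have "(E \<tau> *\<^sub>v ?g v) $ i - (E \<tau> *\<^sub>v ?g w) $ i = (E \<tau> *\<^sub>v (?g v - ?g w)) $ i"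
    using i E_carrier[of \<tau>] by (simp del: index_mult_mat_vec)
  also have "\<bar>\<dots>\<bar> \<le> (1 + \<tau> * F1) * e"
  proof (rule rate_matrix_mat_exp_index_le[OF rate n \<tau> _ i])
    fix j assume j: "j < n"
    have vw: "\<bar>v $ j - w $ j\<bar> \<le> e"
      using abs_vec_index_le_max_norm[of j "v - w"] le v w j by auto
    have "\<bar>f (v $ j) - f (w $ j)\<bar> \<le> F1 * \<bar>v $ j - w $ j\<bar>"
      using v w j by (intro C1_on_with_deriv_lipschitz[OF C1] index_in_interval)
    also have "\<dots> \<le> F1 * e"
      using vw F1_nonneg by (intro mult_left_mono)
    finally have "\<bar>\<tau> * (f (v $ j) - f (w $ j))\<bar> \<le> \<tau> * (F1 * e)"
      using \<tau> by (simp add: abs_mult mult_left_mono)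
    moreover have "(?g v - ?g w) $ j = (v $ j - w $ j) + \<tau> * (f (v $ j) - f (w $ j))"
      using v w j by (simp add: algebra_simps)
    ultimately show "\<bar>(?g v - ?g w) $ j\<bar> \<le> (1 + \<tau> * F1) * e"
      using vw by (simp add: algebra_simps)
  qed (use c in auto)
  finally show ?thesis .
qed

lemma LRI1a_error:
  assumes f: "f \<beta> \<le> 0" "0 \<le> f (- \<beta>)" and \<tau>: "0 < \<tau>" "\<tau> \<le> omega0 f' \<beta>" "real M * \<tau> \<le> T"
    and U: "LRI1a A f \<tau> M (u 0) U" and m: "m \<le> M"
  shows "max_norm (U m - u (real m * \<tau>)) \<le> L / F1 * (exp (F1 * (real m * \<tau>)) - 1) * \<tau>"
proof -
  note step = step_le_omega0_imp[OF C1 \<tau>(1,2) \<beta>]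
  have L: "0 \<le> L"
    using F0_nonneg F1_nonneg a_nonneg \<beta> by (auto simp: L_def)
  have time: "real k * \<tau> \<in> {0..T}" if "k \<le> M" for k
  proof -
    have "real k * \<tau> \<le> real M * \<tau>" using that \<tau> by (intro mult_right_mono) auto
    from order_trans[OF this \<tau>(3)] show ?thesis using \<tau>(1) by simp
  qed
  \<comment> \<open>The range bound belongs to the induction because stability of the next step
    depends on it. The error term solves
    \<open>e (m + 1) = (1 + \<tau> * F1) * e m + L * \<tau>\<^sup>2\<close> with
    \<open>e 0 = 0\<close>.\<close>
  have "U m \<in> carrier_vec n \<and> max_norm (U m) \<le> \<beta> \<and>
      max_norm (U m - u (real m * \<tau>)) \<le> L / F1 * ((1 + \<tau> * F1) ^ m - 1) * \<tau>"
    using m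
  proof (induction m)
    case 0
    have "u 0 - u 0 = 0\<^sub>v n" using u_carrier[of 0] T by auto
    moreover have "max_norm (0\<^sub>v n) \<le> 0" using n by (subst max_norm_le_iff) auto
    ultimately show ?case
      using U u_carrier[of 0] bounded[of 0] T by (auto simp: LRI1a_def)
  next
    case (Suc m)
    let ?t = "real m * \<tau>"
    let ?e = "L / F1 * ((1 + \<tau> * F1) ^ m - 1) * \<tau>"
    have IH: "U m \<in> carrier_vec n" "max_norm (U m) \<le> \<beta>" "max_norm (U m - u ?t) \<le> ?e"
      using Suc by auto
    have t: "?t \<in> {0..T}" "real (Suc m) * \<tau> \<in> {0..T}" using time[of m] time[of "Suc m"] Suc.prems by auto
    have t': "real (Suc m) * \<tau> = ?t + \<tau>" by (simp add: algebra_simps)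
    have US: "U (Suc m) = E \<tau> *\<^sub>v (U m + \<tau> \<cdot>\<^sub>v map_vec f (U m))"
      using U Suc.prems by (simp add: LRI1a_def)
    have c: "U m + \<tau> \<cdot>\<^sub>v map_vec f (U m) \<in> carrier_vec n"
      using IH by auto
    have USc: "U (Suc m) \<in> carrier_vec n"
      unfolding US by (rule mult_mat_vec_carrier[OF E_carrier c])
    have "\<bar>U (Suc m) $ i\<bar> \<le> \<beta>" if i: "i < n" for i
      unfolding US
    proof (rule rate_matrix_mat_exp_index_le[OF rate n _ c i])
      fix j assume j: "j < n"
      show "\<bar>(U m + \<tau> \<cdot>\<^sub>v map_vec f (U m)) $ j\<bar> \<le> \<beta>"
        using explicit_step_bound[OF C1 f \<tau>(1) step(2) index_in_interval[OF IH(1,2) j]] j IH(1) by simp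
    qed (use \<tau> in auto)
    then have bound: "max_norm (U (Suc m)) \<le> \<beta>"
      using n USc by (subst max_norm_le_iff) auto
    have "\<bar>U (Suc m) $ i - u (?t + \<tau>) $ i\<bar> \<le> (1 + \<tau> * F1) * ?e + L * \<tau>\<^sup>2" if i: "i < n" for i
      using step_stable[OF _ IH(1,2) u_carrier[OF t(1)] bounded[OF t(1)] IH(3) i, of \<tau>]
        local_error[of ?t \<tau>, OF _ _ _ i] t \<tau> unfolding US t'
      by (simp del: index_mult_mat_vec)
    \<comment> \<open>Division by \<open>F1\<close> is legitimate since the step size restriction
      forces \<open>F1 > 0\<close>.\<close>
    moreover have "(1 + \<tau> * F1) * ?e + L * \<tau>\<^sup>2 = L / F1 * ((1 + \<tau> * F1) ^ Suc m - 1) * \<tau>"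
      using step(1) by (simp add: field_simps power2_eq_square)
    ultimately have "max_norm (U (Suc m) - u (real (Suc m) * \<tau>)) \<le> L / F1 * ((1 + \<tau> * F1) ^ Suc m - 1) * \<tau>"
      using n USc u_carrier[OF t(2)] unfolding t' by (subst max_norm_le_iff) auto
    then show ?case using USc bound by auto
  qed
  moreover have "L / F1 * ((1 + \<tau> * F1) ^ m - 1) * \<tau> \<le> L / F1 * (exp (F1 * (real m * \<tau>)) - 1) * \<tau>"
  proof -
    \<comment> \<open>The inequality \<open>1 + x \<le> exp x\<close>, raised to the power
      \<open>m\<close>, brings in the exponential of the final time.\<close>
    have "(1 + \<tau> * F1) ^ m \<le> exp (\<tau> * F1) ^ m"
      using \<tau> step(1) by (intro power_mono) auto
    also have "\<dots> = exp (F1 * (real m * \<tau>))"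
      by (simp add: exp_of_nat_mult[symmetric] mult_ac)
    finally show ?thesis
      using L step(1) \<tau> by (intro mult_right_mono mult_left_mono) auto
  qed
  ultimately show ?thesis by linarith
qed

end

section \<open>The constant for the Neumann discretization\<close>

lemma prod_list_pos: "\<forall>n\<in>set ns. 0 < n \<Longrightarrow> 0 < prod_list (ns :: nat list)"
  by (induction ns) auto

theorem theorem5:
  shows "\<exists>C :: real \<Rightarrow> real \<Rightarrow> real \<Rightarrow> real \<Rightarrow> real.
    \<forall>(T :: real) (h :: real) (\<epsilon> :: real) (ns :: nat list) a b
      (f :: real \<Rightarrow> real) f' (\<beta> :: real) u0 u.
      T > 0 \<and> \<epsilon> > 0 \<and> uniform_grid h ns a b \<and>
      \<beta> > 0 \<and> f \<beta> \<le> 0 \<and> 0 \<le> f (- \<beta>) \<and>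
      C1_on_with_deriv {-\<beta>..\<beta>} f f' \<and> \<not> f constant_on {-\<beta>..\<beta>} \<and>
      sup_norm_on (closed_box a b) u0 \<le> ereal \<beta> \<and>
      exact_solution (system_matrix \<epsilon> h ns) f T (grid_restriction h ns a u0) u \<and>
      (\<forall>t\<in>{0..T}. max_norm (u t) \<le> \<beta>)
      \<longrightarrow>
      (let A = system_matrix \<epsilon> h ns; F0 = max_abs f \<beta>; F1 = max_abs f' \<beta>;
           K = C \<beta> F0 F1 (mat_max_norm A)
       in K > 0 \<and>
          (\<forall>(M :: nat) U. let dt = T / real M in
             M > 0 \<and> 0 < dt \<and> dt \<le> omega0 f' \<beta> \<and> LRI1a A f dt M (u 0) U \<longrightarrow>
             (\<forall>m\<le>M. max_norm (U m - u (real m * dt)) \<le> K * (exp (F1 * (real m * dt)) - 1) * dt)))"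
proof -
  \<comment> \<open>The absolute value and the added one make the constant positive for all
    arguments, even for \<open>F1 = 0\<close>, where the quotient is zero by convention; it still
    dominates \<open>L / F1\<close>.\<close>
  define C :: "real \<Rightarrow> real \<Rightarrow> real \<Rightarrow> real \<Rightarrow> real" where
    "C = (\<lambda>\<beta> F0 F1 a. \<bar>(F1 * (a * \<beta> + F0) + a * F0) / F1\<bar> + 1)"
  show ?thesis
  proof (rule exI[of _ C], intro allI impI, elim conjE)
    fix T h \<epsilon> :: real and ns :: "nat list" and a b and f f' :: "real \<Rightarrow> real" and \<beta> :: real and u0 u
    assume T: "0 < T" and grid: "uniform_grid h ns a b" and \<beta>: "0 < \<beta>"
      and f: "f \<beta> \<le> 0" "0 \<le> f (- \<beta>)" and C1: "C1_on_with_deriv {-\<beta>..\<beta>} f f'"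
      and sol: "exact_solution (system_matrix \<epsilon> h ns) f T (grid_restriction h ns a u0) u"
      and bounded: "\<forall>t\<in>{0..T}. max_norm (u t) \<le> \<beta>"
    interpret semilinear_rate_system "system_matrix \<epsilon> h ns" "prod_list ns" f f' \<beta> T u
    proof
      show "rate_matrix (prod_list ns) (system_matrix \<epsilon> h ns)"
        using grid by (intro rate_matrix_system_matrix) (auto simp: uniform_grid_def)
      show "0 < prod_list ns"
        using grid by (intro prod_list_pos) (auto simp: uniform_grid_def)
      have "u 0 = grid_restriction h ns a u0"
        using sol by (simp add: exact_solution_def)
      then show "exact_solution (system_matrix \<epsilon> h ns) f T (u 0) u"
        using sol by simp
      show "max_norm (u t) \<le> \<beta>" if "t \<in> {0..T}" for t
        using bounded that by blast
    qed (fact T \<beta> C1)+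
    show "let A = system_matrix \<epsilon> h ns; F0 = max_abs f \<beta>; F1 = max_abs f' \<beta>;
           K = C \<beta> F0 F1 (mat_max_norm A)
       in K > 0 \<and>
          (\<forall>(M :: nat) U. let dt = T / real M in
             M > 0 \<and> 0 < dt \<and> dt \<le> omega0 f' \<beta> \<and> LRI1a A f dt M (u 0) U \<longrightarrow>
             (\<forall>m\<le>M. max_norm (U m - u (real m * dt)) \<le> K * (exp (F1 * (real m * dt)) - 1) * dt))"
      unfolding Let_def
    proof (intro conjI allI impI, goal_cases)
      case 1
      show ?case unfolding C_def by (rule add_nonneg_pos) auto
    next
      case (2 M U m)
      let ?\<tau> = "T / real M" and ?F1 = "max_abs f' \<beta>"
      \<comment> \<open>This factor is nonnegative, so enlarging \<open>L / F1\<close> to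
        \<open>C\<close> preserves the bound.\<close>
      let ?x = "(exp (?F1 * (real m * ?\<tau>)) - 1) * ?\<tau>"
      have "max_norm (U m - u (real m * ?\<tau>)) \<le> L / ?F1 * (exp (?F1 * (real m * ?\<tau>)) - 1) * ?\<tau>"
        using 2 by (intro LRI1a_error[OF f]) auto
      also have "\<dots> = L / ?F1 * ?x" by (simp only: mult.assoc)
      also have "\<dots> \<le> C \<beta> (max_abs f \<beta>) ?F1 (mat_max_norm (system_matrix \<epsilon> h ns)) * ?x"
      proof (rule mult_right_mono)
        have "L / ?F1 \<le> \<bar>L / ?F1\<bar> + 1" by linarith
        then show "L / ?F1 \<le> C \<beta> (max_abs f \<beta>) ?F1 (mat_max_norm (system_matrix \<epsilon> h ns))"
          unfolding C_def L_def .
        have "0 \<le> ?F1 * (real m * ?\<tau>)"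
          using 2 F1_nonneg by (intro mult_nonneg_nonneg) auto
        then show "0 \<le> ?x"
          using 2 by (intro mult_nonneg_nonneg) auto
      qed
      finally show ?case by (simp only: mult.assoc)
    qed
  qed
qed

end
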